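(* Colored Token Swapping restricted to complete graphs is fixed-parameter tractable when parameterized by the number $c$ of colors; that is, given a complete graph $G$ on $n$ vertices, token-placements $f_0,f_t\colon V(G)\to\{1,\dots,c\}$ and an integer $\ell$, one can decide whether $\mathrm{OPT}(f_0,f_t)\le\ell$ in time $g(c)\cdot n^{O(1)}$ for some computable function $g$.
   Context: A token-placement of $G=(V,E)$ with colors $C=\{1,\dots,c\}$ is a surjective map $f\colon V\to C$. Two distinct token-placements $f,f'$ are adjacent if there is an edge $uv\in E$ with $f'(u)=f(v)$, $f'(v)=f(u)$ and $f'(w)=f(w)$ for all other $w$. A swapping sequence between $f$ and $f'$ is a sequence $f_1=f,\dots,f_h=f'$ of token-placements with consecutive members adjacent; its length is $h-1$. $\mathrm{OPT}(f,f')$ is the minimum length of such a sequence ($\infty$ if none). *)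

theory Defs
  imports Main "HOL-Library.Extended_Nat"
begin

text \<open>A graph is given by a vertex set {0..<n} and an edge predicate E.
  A token-placement with colours {1..c} is a list f of length n
  (f ! v is the colour of vertex v) that is surjective onto {1..c}.\<close>

definition token_placement :: "nat \<Rightarrow> nat \<Rightarrow> nat list \<Rightarrow> bool" where
  "token_placement n c f \<longleftrightarrow> length f = n \<and> set f = {1..c}"

definition adjacent_placements ::
    "nat \<Rightarrow> nat \<Rightarrow> (nat \<Rightarrow> nat \<Rightarrow> bool) \<Rightarrow> nat list \<Rightarrow> nat list \<Rightarrow> bool" where
  "adjacent_placements n c E f f' \<longleftrightarrow>
     token_placement n c f \<and> token_placement n c f' \<and> f \<noteq> f' \<and>
     (\<exists>u v. u < n \<and> v < n \<and> E u v \<and>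
        f' ! u = f ! v \<and> f' ! v = f ! u \<and>
        (\<forall>w < n. w \<noteq> u \<longrightarrow> w \<noteq> v \<longrightarrow> f' ! w = f ! w))"

definition swap_rel :: "nat \<Rightarrow> nat \<Rightarrow> (nat \<Rightarrow> nat \<Rightarrow> bool) \<Rightarrow> (nat list \<times> nat list) set" where
  "swap_rel n c E = {(f, f'). adjacent_placements n c E f f'}"

text \<open>OPT(f,f'): minimum length of a swapping sequence (infinity if none).
  A swapping sequence of length k is a k-fold chain in swap_rel; length 0
  is the trivial sequence f_1 = f = f'.\<close>

definition OPT :: "nat \<Rightarrow> nat \<Rightarrow> (nat \<Rightarrow> nat \<Rightarrow> bool) \<Rightarrow> nat list \<Rightarrow> nat list \<Rightarrow> enat" where
  "OPT n c E f f' =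
     (INF k \<in> {k. token_placement n c f \<and> (f, f') \<in> (swap_rel n c E) ^^ k}. enat k)"

definition complete_graph :: "nat \<Rightarrow> nat \<Rightarrow> bool" where
  "complete_graph u v \<longleftrightarrow> u \<noteq> v"

text \<open>Registers are indexed by nat and hold nat values; indirect addressing
  is available. Unit-cost RAMs with only +,- (no multiplication) are
  polynomially equivalent to Turing machines.\<close>

datatype instr =
    LoadC nat nat
  | Add nat nat nat
  | Sub nat nat nat
  | LoadI nat nat
  | StoreI nat nat
  | Jz nat nat

type_synonym config = "nat \<times> (nat \<Rightarrow> nat)"

fun exec :: "instr \<Rightarrow> config \<Rightarrow> config" where
  "exec (LoadC r k) (pc, R) = (Suc pc, R(r := k))"
| "exec (Add r a b) (pc, R) = (Suc pc, R(r := R a + R b))"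
| "exec (Sub r a b) (pc, R) = (Suc pc, R(r := R a - R b))"
| "exec (LoadI r a) (pc, R) = (Suc pc, R(r := R (R a)))"
| "exec (StoreI a r) (pc, R) = (Suc pc, R(R a := R r))"
| "exec (Jz r t) (pc, R) = (if R r = 0 then t else Suc pc, R)"

definition step :: "instr list \<Rightarrow> config \<Rightarrow> config" where
  "step P cf = (if fst cf < length P then exec (P ! fst cf) cf else cf)"

definition init_config :: "nat list \<Rightarrow> config" where
  "init_config xs = (0, \<lambda>i. if i < length xs then xs ! i else 0)"

definition halts_within :: "instr list \<Rightarrow> nat list \<Rightarrow> nat \<Rightarrow> nat \<Rightarrow> bool" where
  "halts_within P xs t y \<longleftrightarrow>
     (\<exists>k \<le> t. fst ((step P ^^ k) (init_config xs)) \<ge> length P \<and>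
              snd ((step P ^^ k) (init_config xs)) 0 = y)"

definition ram_computable :: "(nat \<Rightarrow> nat) \<Rightarrow> bool" where
  "ram_computable g \<longleftrightarrow> (\<exists>Q. \<forall>x. \<exists>t. halts_within Q [x] t (g x))"

end

theory Submission
  imports Defs "HOL-Library.Multiset"
begin

text \<open>OPT equals n minus the largest k such that the multiset of pairs (f0 v, ft v) is a sum of k
  nonempty balanced parts, a part being balanced if its first and second components form the same
  multiset: one swap merges at most two parts, and conversely a swap inside a part of size at least 2
  can split off a pair (q, q).

  In an optimal decomposition every part is a set of pairs (a permutation of some colours), so with
  m = c * c there are at most 2 ^ m kinds of parts. If kind g occurs x g times, then after
  a fraction t / n of the pairs of every colour type has been fed in and t * x g div n parts of
  kind g have been split off, between 0 and 2 ^ m + 1 pairs of each type are left over. A dynamic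
  program over these left-overs, encoded as numbers with m digits in base 2 ^ (m + 2), thus has a
  number of states depending on c only. It is run on the RAM via a small verified compiler from a
  language of bounded loops and arrays.\<close>

section \<open>A loop language and its compilation\<close>

text \<open>Maximising the number of parts is an integer program in up to \<open>2 ^ m\<close>
  unknown multiplicities \<open>x g\<close>, and a table indexed by all sub-multisets of the pairs
  would have about n^(c^2) entries, too many for fixed-parameter tractability. The proportional
  schedule acts like a Steinitz rearrangement: it orders feeding and splitting so that all partial
  differences stay bounded in terms of c. They are nonnegative by superadditivity of the floor, and
  bounded above because each of at most \<open>2 ^ m\<close> floors loses less than 1, plus one
  token fed in ahead of the splitting. The multiplicities are never guessed: in each round the
  program may split off every balanced code at most once, which is enough as
  \<open>x g \<le> n\<close> and there are n rounds; whatever else it tries is sound too. Feeding in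
  n-ths through integer counters avoids division, and a power of two as base turns multiplications
  by the base into doublings, so addition, truncated subtraction and bounded loops suffice.\<close>

datatype cmd =
    Const nat nat
  | Plus nat nat nat
  | Minus nat nat nat
  | Get nat nat nat
  | Put nat nat nat
  | Seq cmd cmd (infixr ";;" 60)
  | Loop nat cmd

type_synonym store = "(nat \<Rightarrow> nat) \<times> (nat \<Rightarrow> nat \<Rightarrow> nat)"

fun sem :: "cmd \<Rightarrow> store \<Rightarrow> store" where
  "sem (Const x k) s = ((fst s)(x := k), snd s)"
| "sem (Plus x y z) s = ((fst s)(x := fst s y + fst s z), snd s)"
| "sem (Minus x y z) s = ((fst s)(x := fst s y - fst s z), snd s)"
| "sem (Get x k y) s = ((fst s)(x := snd s k (fst s y)), snd s)"
| "sem (Put k y z) s = (fst s, (snd s)(k := (snd s k)(fst s y := fst s z)))"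
| "sem (c1 ;; c2) s = sem c2 (sem c1 s)"
| "sem (Loop x c) s = (sem c ^^ fst s x) s"

text \<open>Exact numbers of machine steps: an array access is ten address instructions and one
  transfer; a loop takes one step to load its counter, one for the final test, and three per
  iteration for test, decrement and jump back.\<close>

fun cost :: "cmd \<Rightarrow> store \<Rightarrow> nat" where
  "cost (Const x k) s = 1"
| "cost (Plus x y z) s = 1"
| "cost (Minus x y z) s = 1"
| "cost (Get x k y) s = 11"
| "cost (Put k y z) s = 11"
| "cost (c1 ;; c2) s = cost c1 s + cost c2 (sem c1 s)"
| "cost (Loop x c) s = 2 + (\<Sum>j<fst s x. 3 + cost c ((sem c ^^ j) s))"

text \<open>Registers below 64 hold the variables; 65 is scratch, 66 the array base, 67 and 68 the
  constants 0 and 1, and 70 + d the counter of the loop at nesting depth d. Entry i of array k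
  sits at address base + 8 * i + k.\<close>

definition addr_code :: "nat \<Rightarrow> nat \<Rightarrow> instr list" where
  "addr_code k y = LoadC 65 k # Add 65 65 66 # map (\<lambda>_. Add 65 65 y) [1, 2, 3, 4, 5, 6, 7, 8 :: nat]"

text \<open>Jump targets are absolute, hence the position \<open>p\<close>. The bound is copied into
  a separate counter because \<open>sem\<close> fixes the iteration count on entry while the body
  may change \<open>x\<close>. \<open>Jz 67\<close> jumps unconditionally.\<close>

fun compile :: "nat \<Rightarrow> nat \<Rightarrow> cmd \<Rightarrow> instr list" where
  "compile d p (Const x k) = [LoadC x k]"
| "compile d p (Plus x y z) = [Add x y z]"
| "compile d p (Minus x y z) = [Sub x y z]"
| "compile d p (Get x k y) = addr_code k y @ [LoadI x 65]"
| "compile d p (Put k y z) = addr_code k y @ [StoreI 65 z]"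
| "compile d p (c1 ;; c2) = compile d p c1 @ compile d (p + length (compile d p c1)) c2"
| "compile d p (Loop x c) =
     (let B = compile (Suc d) (p + 2) c
      in [Add (70 + d) x 67, Jz (70 + d) (p + 4 + length B)] @ B
           @ [Sub (70 + d) (70 + d) 68, Jz 67 (Suc p)])"

text \<open>The depth limit keeps every counter \<open>70 + d\<close> below 128, hence below the
  arrays, so that \<open>Put\<close> cannot overwrite the counter of an enclosing loop.\<close>

fun well_formed :: "nat \<Rightarrow> cmd \<Rightarrow> bool" where
  "well_formed d (Const x k) \<longleftrightarrow> x < 64"
| "well_formed d (Plus x y z) \<longleftrightarrow> x < 64 \<and> y < 64 \<and> z < 64"
| "well_formed d (Minus x y z) \<longleftrightarrow> x < 64 \<and> y < 64 \<and> z < 64"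
| "well_formed d (Get x k y) \<longleftrightarrow> x < 64 \<and> k < 8 \<and> y < 64"
| "well_formed d (Put k y z) \<longleftrightarrow> d \<le> 50 \<and> k < 8 \<and> y < 64 \<and> z < 64"
| "well_formed d (c1 ;; c2) \<longleftrightarrow> well_formed d c1 \<and> well_formed d c2"
| "well_formed d (Loop x c) \<longleftrightarrow> x < 64 \<and> d < 50 \<and> well_formed (Suc d) c"

definition sim :: "nat \<Rightarrow> store \<Rightarrow> (nat \<Rightarrow> nat) \<Rightarrow> bool" where
  "sim b s R \<longleftrightarrow> 128 \<le> b \<and> (\<forall>x < 64. R x = fst s x) \<and> R 66 = b \<and> R 67 = 0 \<and> R 68 = 1
     \<and> (\<forall>k < 8. \<forall>i. R (b + 8 * i + k) = snd s k i)"

section \<open>Simulation of loop programs on the RAM\<close>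

fun straight :: "instr \<Rightarrow> bool" where
  "straight (Jz r t) = False"
| "straight _ = True"

lemma exec_straight: "straight i \<Longrightarrow> exec i (p, R) = (Suc p, snd (exec i (0, R)))"
  by (cases i) auto

definition effect :: "instr list \<Rightarrow> (nat \<Rightarrow> nat) \<Rightarrow> nat \<Rightarrow> nat" where
  "effect is R = fold (\<lambda>i R. snd (exec i (0, R))) is R"

lemma effect_simps [simp]:
  "effect [] R = R"
  "effect (i # is) R = effect is (snd (exec i (0, R)))"
  by (auto simp: effect_def)

lemma step_at: "step (pre @ i # post) (length pre, R) = exec i (length pre, R)"
  by (simp add: step_def)

lemma run_straight:
  assumes "list_all straight is"
  shows "(step (pre @ is @ post) ^^ length is) (length pre, R)
           = (length pre + length is, effect is R)"
  using assms
proof (induction "is" arbitrary: pre R)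
  case (Cons i "is")
  have "step (pre @ (i # is) @ post) (length pre, R) = (Suc (length pre), snd (exec i (0, R)))"
    using step_at[of pre i "is @ post" R] exec_straight[of i "length pre" R] Cons.prems by simp
  moreover have "(step (pre @ (i # is) @ post) ^^ length is) (Suc (length pre), snd (exec i (0, R)))
      = (length pre + length (i # is), effect (i # is) R)"
    using Cons.IH[of "pre @ [i]" "snd (exec i (0, R))"] Cons.prems by simp
  ultimately show ?case by (simp add: funpow_Suc_right del: funpow.simps)
qed simp

lemma funpow_trans:
  "(f ^^ a) x = y \<Longrightarrow> (f ^^ b) y = z \<Longrightarrow> (f ^^ (a + b)) x = z"
  by (metis add.commute comp_apply funpow_add)

lemma effect_addr:
  assumes "y < 64"
  shows "effect (addr_code k y @ is) R = effect is (R(65 := k + R 66 + 8 * R y))"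
proof -
  have "effect (addr_code k y @ is) R
      = effect is (R(65 := k + R 66 + R y + R y + R y + R y + R y + R y + R y + R y))"
    using assms by (simp add: addr_code_def)
  moreover have "k + R 66 + R y + R y + R y + R y + R y + R y + R y + R y = k + R 66 + 8 * R y"
    by simp
  ultimately show ?thesis by (simp only:)
qed

lemma length_addr [simp]: "length (addr_code k y) = 10"
  by (simp add: addr_code_def)

lemma straight_addr [simp]: "list_all straight (addr_code k y)"
  by (simp add: addr_code_def)

lemma sim_cell_inj:
  fixes k k' i i' :: nat
  assumes "8 * i + k = 8 * i' + k'" "k < 8" "k' < 8"
  shows "k = k'" "i = i'"
  using assms by presburger+

lemma sim_assign:
  "\<lbrakk>sim b s R; x < 64; w = u\<rbrakk> \<Longrightarrow> sim b ((fst s)(x := w), snd s) (R(x := u))"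
  by (auto simp: sim_def)

lemma sim_scratch: "sim b s R \<Longrightarrow> sim b s (R(65 := u))"
  by (auto simp: sim_def)

lemma sim_put:
  assumes "sim b s R" "k < 8" "w = u"
  shows "sim b (fst s, (snd s)(k := (snd s k)(i := w))) (R(b + 8 * i + k := u))"
proof -
  have "(R(b + 8 * i + k := u)) (b + 8 * i' + k') = ((snd s)(k := (snd s k)(i := w))) k' i'"
    if "k' < 8" for k' i'
  proof (cases "k = k' \<and> i = i'")
    case False
    then have "b + 8 * i' + k' \<noteq> b + 8 * i + k"
      using sim_cell_inj[of i k i' k'] assms(2) that by auto
    with False that assms(1) show ?thesis by (auto simp: sim_def)
  qed (use assms in simp)
  with assms show ?thesis by (auto simp: sim_def)
qed

text \<open>\<open>pre\<close> and \<open>post\<close> are arbitrary because the induction descends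
  to subprograms at other positions. The last conjunct protects the counters of enclosing loops; the
  loop case applies it to its own body at depth \<open>Suc d\<close>.\<close>

lemma compile_correct:
  assumes "well_formed d c" "sim b s R"
  shows "\<exists>R'. (step (pre @ compile d (length pre) c @ post) ^^ cost c s) (length pre, R)
                = (length pre + length (compile d (length pre) c), R')
            \<and> sim b (sem c s) R' \<and> (\<forall>j < d. R' (70 + j) = R (70 + j))"
  using assms
proof (induction c arbitrary: d s R pre post)
  case (Const x k)
  have "(step (pre @ [LoadC x k] @ post) ^^ 1) (length pre, R) = (length pre + 1, R(x := k))"
    using run_straight[of "[LoadC x k]" pre post R] by simp
  then show ?case using Const by (auto intro!: sim_assign)
next
  case (Plus x y z)
  have "(step (pre @ [Add x y z] @ post) ^^ 1) (length pre, R) = (length pre + 1, R(x := R y + R z))"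
    using run_straight[of "[Add x y z]" pre post R] by simp
  moreover have "fst s y + fst s z = R y + R z" using Plus by (auto simp: sim_def)
  ultimately show ?case using Plus by (auto intro!: sim_assign)
next
  case (Minus x y z)
  have "(step (pre @ [Sub x y z] @ post) ^^ 1) (length pre, R) = (length pre + 1, R(x := R y - R z))"
    using run_straight[of "[Sub x y z]" pre post R] by simp
  moreover have "fst s y - fst s z = R y - R z" using Minus by (auto simp: sim_def)
  ultimately show ?case using Minus by (auto intro!: sim_assign)
next
  case (Get x k y)
  define R1 where "R1 = R(65 := k + R 66 + 8 * R y)"
  have "(step (pre @ (addr_code k y @ [LoadI x 65]) @ post) ^^ 11) (length pre, R)
           = (length pre + 11, R1(x := R1 (R1 65)))"
    using run_straight[of "addr_code k y @ [LoadI x 65]" pre post R] Get.prems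
    by (simp add: effect_addr R1_def)
  moreover have s1: "sim b s R1" using Get.prems by (auto simp: R1_def intro: sim_scratch)
  moreover have "R1 65 = b + 8 * fst s y + k"
    using Get.prems by (auto simp: R1_def sim_def)
  then have "snd s k (fst s y) = R1 (R1 65)"
    using s1 Get.prems by (auto simp: sim_def)
  ultimately show ?case using Get.prems
    by (auto simp: R1_def intro!: sim_assign)
next
  case (Put k y z)
  define R1 where "R1 = R(65 := k + R 66 + 8 * R y)"
  have "(step (pre @ (addr_code k y @ [StoreI 65 z]) @ post) ^^ 11) (length pre, R)
           = (length pre + 11, R1(R1 65 := R1 z))"
    using run_straight[of "addr_code k y @ [StoreI 65 z]" pre post R] Put.prems
    by (simp add: effect_addr R1_def)
  moreover have s1: "sim b s R1" using Put.prems by (auto simp: R1_def intro: sim_scratch)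
  moreover have a: "R1 65 = b + 8 * fst s y + k"
    using Put.prems by (auto simp: R1_def sim_def)
  moreover have "128 \<le> b" "fst s z = R1 z" using s1 Put.prems by (auto simp: sim_def)
  moreover have "sim b (sem (Put k y z) s) (R1(R1 65 := R1 z))"
    unfolding a using s1 Put.prems \<open>fst s z = R1 z\<close> by (auto intro: sim_put)
  moreover have "\<forall>j<d. R1 (70 + j) = R (70 + j)" by (simp add: R1_def)
  ultimately show ?case using Put.prems by auto
next
  case (Seq c1 c2)
  let ?c1 = "compile d (length pre) c1"
  let ?c2 = "compile d (length pre + length ?c1) c2"
  obtain R1 where R1: "(step (pre @ ?c1 @ ?c2 @ post) ^^ cost c1 s) (length pre, R)
        = (length pre + length ?c1, R1)" "sim b (sem c1 s) R1" "\<forall>j<d. R1 (70 + j) = R (70 + j)"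
    using Seq.IH(1)[of d s R pre "?c2 @ post"] Seq.prems by auto
  obtain R2 where R2: "(step (pre @ ?c1 @ ?c2 @ post) ^^ cost c2 (sem c1 s)) (length pre + length ?c1, R1)
        = (length pre + length ?c1 + length ?c2, R2)" "sim b (sem c2 (sem c1 s)) R2"
        "\<forall>j<d. R2 (70 + j) = R1 (70 + j)"
    using Seq.IH(2)[of d "sem c1 s" R1 "pre @ ?c1" post] R1(2) Seq.prems by auto
  show ?case
    using funpow_trans[OF R1(1) R2(1)] R2(2,3) R1(3) by (auto simp: add_ac)
next
  case (Loop x c)
  let ?p = "length pre"
  let ?B = "compile (Suc d) (?p + 2) c"
  let ?C = "70 + d"
  let ?P = "pre @ compile d ?p (Loop x c) @ post"
  let ?s = "\<lambda>j. (sem c ^^ j) s"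
  have wf: "well_formed (Suc d) c" "x < 64" "d < 50" using Loop.prems by auto
  have P1: "?P = pre @ Add ?C x 67 # (Jz ?C (?p + 4 + length ?B) # ?B @ [Sub ?C ?C 68, Jz 67 (Suc ?p)] @ post)"
    and P2: "?P = (pre @ [Add ?C x 67]) @ Jz ?C (?p + 4 + length ?B) # (?B @ [Sub ?C ?C 68, Jz 67 (Suc ?p)] @ post)"
    and P3: "?P = (pre @ [Add ?C x 67, Jz ?C (?p + 4 + length ?B)]) @ ?B @ ([Sub ?C ?C 68, Jz 67 (Suc ?p)] @ post)"
    and P4: "?P = (pre @ [Add ?C x 67, Jz ?C (?p + 4 + length ?B)] @ ?B) @ Sub ?C ?C 68 # ([Jz 67 (Suc ?p)] @ post)"
    and P5: "?P = (pre @ [Add ?C x 67, Jz ?C (?p + 4 + length ?B)] @ ?B @ [Sub ?C ?C 68]) @ Jz 67 (Suc ?p) # post"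
    by (simp_all add: Let_def)
  have S1: "step ?P (?p, R') = (Suc ?p, R'(?C := R' x + R' 67))" for R'
    unfolding P1 by (subst step_at) simp
  have S2: "step ?P (Suc ?p, R') = (if R' ?C = 0 then ?p + 4 + length ?B else ?p + 2, R')" for R'
    unfolding P2 using step_at[of "pre @ [Add ?C x 67]"] by simp
  have S4: "step ?P (?p + 2 + length ?B, R') = (?p + 3 + length ?B, R'(?C := R' ?C - R' 68))" for R'
    unfolding P4 using step_at[of "pre @ [Add ?C x 67, Jz ?C (?p + 4 + length ?B)] @ ?B"]
    by (simp add: eval_nat_numeral)
  have S5: "step ?P (?p + 3 + length ?B, R') = (if R' 67 = 0 then Suc ?p else ?p + 4 + length ?B, R')" for R'
    unfolding P5 using step_at[of "pre @ [Add ?C x 67, Jz ?C (?p + 4 + length ?B)] @ ?B @ [Sub ?C ?C 68]"]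
    by (simp add: eval_nat_numeral)
  have simC: "sim b s' (R'(?C := u))" if "sim b s' R'" for s' R' u
    using that wf by (auto simp: sim_def)
  \<comment> \<open>Measured at the loop test: after \<open>j\<close> iterations the machine stands
    before the conditional jump. The leading 1 is the load of the counter.\<close>
  have iter: "\<exists>R'. (step ?P ^^ (1 + (\<Sum>i<j. 3 + cost c (?s i)))) (?p, R) = (Suc ?p, R')
      \<and> sim b (?s j) R' \<and> R' ?C = fst s x - j \<and> (\<forall>i<d. R' (70 + i) = R (70 + i))"
    if "j \<le> fst s x" for j
    using that
  proof (induction j)
    case 0
    have "R x + R 67 = fst s x" using Loop.prems by (auto simp: sim_def)
    then show ?case using S1[of R] simC[OF Loop.prems(2)] by auto
  next
    case (Suc j)
    then obtain R1 where R1: "(step ?P ^^ (1 + (\<Sum>i<j. 3 + cost c (?s i)))) (?p, R) = (Suc ?p, R1)"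
      "sim b (?s j) R1" "R1 ?C = fst s x - j" "\<forall>i<d. R1 (70 + i) = R (70 + i)" by auto
    have a1: "(step ?P ^^ 1) (Suc ?p, R1) = (?p + 2, R1)" using S2 R1(3) Suc.prems by simp
    obtain R2 where R2: "(step ?P ^^ cost c (?s j)) (?p + 2, R1) = (?p + 2 + length ?B, R2)"
      "sim b (sem c (?s j)) R2" "\<forall>i<Suc d. R2 (70 + i) = R1 (70 + i)"
      using Loop.IH[OF wf(1) R1(2), of "pre @ [Add ?C x 67, Jz ?C (?p + 4 + length ?B)]"
          "[Sub ?C ?C 68, Jz 67 (Suc ?p)] @ post"] unfolding P3 by auto
    define R3 where "R3 = R2(?C := R2 ?C - R2 68)"
    have R3: "sim b (?s (Suc j)) R3" using simC R2(2) by (simp add: R3_def)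
    have "R3 67 = 0" "R2 68 = 1" using R3 R2(2) by (auto simp: sim_def)
    then have a2: "(step ?P ^^ 2) (?p + 2 + length ?B, R2) = (Suc ?p, R3)"
      using S4[of R2] S5[of R3] by (simp add: R3_def eval_nat_numeral)
    have e: "1 + (\<Sum>i<Suc j. 3 + cost c (?s i)) = (1 + (\<Sum>i<j. 3 + cost c (?s i))) + (1 + (cost c (?s j) + 2))"
      by simp
    have "(step ?P ^^ (1 + (\<Sum>i<Suc j. 3 + cost c (?s i)))) (?p, R) = (Suc ?p, R3)"
      unfolding e by (rule funpow_trans[OF R1(1) funpow_trans[OF a1 funpow_trans[OF R2(1) a2]]])
    moreover have "R3 ?C = fst s x - Suc j"
      using R2(3) R1(3) \<open>R2 68 = 1\<close> by (simp add: R3_def)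
    moreover have "\<forall>i<d. R3 (70 + i) = R (70 + i)" using R2(3) R1(4) by (simp add: R3_def)
    ultimately show ?case using R3 by blast
  qed
  obtain R1 where R1: "(step ?P ^^ (1 + (\<Sum>i<fst s x. 3 + cost c (?s i)))) (?p, R) = (Suc ?p, R1)"
      "sim b (?s (fst s x)) R1" "R1 ?C = 0" "\<forall>i<d. R1 (70 + i) = R (70 + i)" using iter[of "fst s x"] by auto
  have "(step ?P ^^ 1) (Suc ?p, R1) = (?p + 4 + length ?B, R1)" using S2 R1(3) by simp
  from funpow_trans[OF R1(1) this]
  have "(step ?P ^^ cost (Loop x c) s) (?p, R) = (?p + length (compile d ?p (Loop x c)), R1)"
    by (simp add: Let_def add_ac del: funpow.simps)
  with R1 show ?case by auto
qed

section \<open>Running times and weakest preconditions\<close>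

fun safe :: "nat \<Rightarrow> cmd \<Rightarrow> store \<Rightarrow> bool" where
  "safe N (c1 ;; c2) s \<longleftrightarrow> safe N c1 s \<and> safe N c2 (sem c1 s)"
| "safe N (Loop x c) s \<longleftrightarrow> fst s x \<le> N \<and> (\<forall>j < fst s x. safe N c ((sem c ^^ j) s))"
| "safe N _ s \<longleftrightarrow> True"

text \<open>Every loop contributes one factor \<open>N + 1\<close>, so \<open>K\<close> and
  \<open>d\<close> depend on the command alone. This uniformity is what makes the final exponent of
  n independent of c.\<close>

lemma cost_poly: "\<exists>K d. \<forall>N s. safe N c s \<longrightarrow> cost c s \<le> K * (N + 1) ^ d"
proof (induction c)
  case (Seq c1 c2)
  then obtain K1 d1 K2 d2 where
    1: "safe N c1 s \<Longrightarrow> cost c1 s \<le> K1 * (N + 1) ^ d1" and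
    2: "safe N c2 s \<Longrightarrow> cost c2 s \<le> K2 * (N + 1) ^ d2" for N s by metis
  have "cost (c1 ;; c2) s \<le> (K1 + K2) * (N + 1) ^ (d1 + d2)" if "safe N (c1 ;; c2) s" for N s
  proof -
    have "cost (c1 ;; c2) s \<le> K1 * (N + 1) ^ d1 + K2 * (N + 1) ^ d2"
      using 1[of N s] 2[of N "sem c1 s"] that by simp
    also have "\<dots> \<le> K1 * (N + 1) ^ (d1 + d2) + K2 * (N + 1) ^ (d1 + d2)"
      by (intro add_mono mult_left_mono power_increasing) auto
    finally show ?thesis by (simp add: algebra_simps)
  qed
  then show ?case by blast
next
  case (Loop x c)
  then obtain K d where 1: "safe N c s \<Longrightarrow> cost c s \<le> K * (N + 1) ^ d" for N s by metis
  have "cost (Loop x c) s \<le> (K + 5) * (N + 1) ^ Suc d" if "safe N (Loop x c) s" for N s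
  proof -
    have "(\<Sum>j<fst s x. 3 + cost c ((sem c ^^ j) s)) \<le> (\<Sum>j<fst s x. 3 + K * (N + 1) ^ d)"
      using that 1 by (intro sum_mono add_left_mono) auto
    also have "\<dots> = fst s x * (3 + K * (N + 1) ^ d)" by simp
    also have "\<dots> \<le> (N + 1) * (3 * (N + 1) ^ d + K * (N + 1) ^ d)"
      using that by (intro mult_mono add_mono) auto
    finally have "cost (Loop x c) s \<le> 2 + (K + 3) * (N + 1) ^ Suc d" by (simp add: algebra_simps)
    also have "\<dots> \<le> 2 * (N + 1) ^ Suc d + (K + 3) * (N + 1) ^ Suc d"
      using one_le_power[of "N + 1" "Suc d"] by (intro add_mono) auto
    finally show ?thesis by (simp add: algebra_simps)
  qed
  then show ?case by blast
qed (rule exI[of _ 11], rule exI[of _ 0], simp)+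

fun writes_var :: "cmd \<Rightarrow> nat \<Rightarrow> bool" where
  "writes_var (Const x k) u \<longleftrightarrow> u = x"
| "writes_var (Plus x y z) u \<longleftrightarrow> u = x"
| "writes_var (Minus x y z) u \<longleftrightarrow> u = x"
| "writes_var (Get x k y) u \<longleftrightarrow> u = x"
| "writes_var (Put k y z) u \<longleftrightarrow> False"
| "writes_var (c1 ;; c2) u \<longleftrightarrow> writes_var c1 u \<or> writes_var c2 u"
| "writes_var (Loop x c) u \<longleftrightarrow> writes_var c u"

fun writes_arr :: "cmd \<Rightarrow> nat \<Rightarrow> bool" where
  "writes_arr (Put k y z) u \<longleftrightarrow> u = k"
| "writes_arr (c1 ;; c2) u \<longleftrightarrow> writes_arr c1 u \<or> writes_arr c2 u"
| "writes_arr (Loop x c) u \<longleftrightarrow> writes_arr c u"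
| "writes_arr _ u \<longleftrightarrow> False"

definition frame :: "cmd \<Rightarrow> store \<Rightarrow> store \<Rightarrow> bool" where
  "frame c s s' \<longleftrightarrow> (\<forall>u. \<not> writes_var c u \<longrightarrow> fst s' u = fst s u)
     \<and> (\<forall>k. \<not> writes_arr c k \<longrightarrow> snd s' k = snd s k)"

lemma frame_sem: "frame c s (sem c s)"
proof (induction c arbitrary: s)
  case (Seq c1 c2)
  from Seq(1)[of s] Seq(2)[of "sem c1 s"] show ?case by (simp add: frame_def)
next
  case (Loop x c)
  have "frame c s ((sem c ^^ j) s)" for j
  proof (induction j)
    case (Suc j)
    with Loop[of "(sem c ^^ j) s"] show ?case by (simp add: frame_def)
  qed (simp add: frame_def)
  then show ?case by (simp add: frame_def)
qed (auto simp: frame_def)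

text \<open>Every command terminates; the bound N on all iteration counts yields the running time through
  cost_poly.\<close>

definition wp :: "nat \<Rightarrow> cmd \<Rightarrow> (store \<Rightarrow> bool) \<Rightarrow> store \<Rightarrow> bool" where
  "wp N c Q s \<longleftrightarrow> safe N c s \<and> Q (sem c s)"

lemma wp_simps [simp]:
  "wp N (Const x k) Q (v, a) = Q (v(x := k), a)"
  "wp N (Plus x y z) Q (v, a) = Q (v(x := v y + v z), a)"
  "wp N (Minus x y z) Q (v, a) = Q (v(x := v y - v z), a)"
  "wp N (Get x k y) Q (v, a) = Q (v(x := a k (v y)), a)"
  "wp N (Put k y z) Q (v, a) = Q (v, a(k := (a k)(v y := v z)))"
  "wp N (c1 ;; c2) Q s = wp N c1 (wp N c2 Q) s"
  by (auto simp: wp_def)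

lemma wp_mono:
  assumes "wp N c P s" "\<And>v a. P (v, a) \<Longrightarrow> frame c s (v, a) \<Longrightarrow> Q (v, a)"
  shows "wp N c Q s"
  using assms frame_sem[of c s] by (cases "sem c s") (auto simp: wp_def)

text \<open>Whatever the body does not write comes back through \<open>frame\<close>, relative to
  the store before the loop, so the invariant \<open>I\<close> need only mention what
  changes.\<close>

lemma wp_loop:
  assumes n: "fst s x = n" "n \<le> N" and I0: "I 0 s"
    and step: "\<And>j v a. j < n \<Longrightarrow> I j (v, a) \<Longrightarrow> frame c s (v, a) \<Longrightarrow> wp N c (I (Suc j)) (v, a)"
    and fin: "\<And>v a. I n (v, a) \<Longrightarrow> frame c s (v, a) \<Longrightarrow> Q (v, a)"
  shows "wp N (Loop x c) Q s"
proof -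
  have fr: "frame c s ((sem c ^^ j) s)" for j
  proof (induction j)
    case (Suc j)
    with frame_sem[of c "(sem c ^^ j) s"] show ?case by (simp add: frame_def)
  qed (simp add: frame_def)
  have I: "I j ((sem c ^^ j) s)" if "j \<le> n" for j
    using that
  proof (induction j)
    case (Suc j)
    with step[of j "fst ((sem c ^^ j) s)" "snd ((sem c ^^ j) s)"] fr[of j] show ?case
      by (simp add: wp_def)
  qed (simp add: I0)
  have "safe N c ((sem c ^^ j) s)" if "j < n" for j
    using step[of j "fst ((sem c ^^ j) s)" "snd ((sem c ^^ j) s)"] fr[of j] I[of j] that
    by (simp add: wp_def)
  moreover have "Q ((sem c ^^ n) s)"
    using fin[of "fst ((sem c ^^ n) s)" "snd ((sem c ^^ n) s)"] fr[of n] I[of n] by simp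
  ultimately show ?thesis using n by (simp add: wp_def)
qed

lemma wp_if:
  assumes "v x = (if b then 1 else 0)" "1 \<le> N"
    "b \<Longrightarrow> wp N c Q (v, a)" "\<not> b \<Longrightarrow> Q (v, a)"
  shows "wp N (Loop x c) Q (v, a)"
  using assms by (cases b) (auto simp: wp_def)

section \<open>Optimal swapping and balanced partitions\<close>

text \<open>With pairs read as arcs between colours: a directed multigraph in which every colour has
  equal in- and out-degree.\<close>

definition balanced :: "('a \<times> 'a) multiset \<Rightarrow> bool" where
  "balanced g \<longleftrightarrow> image_mset fst g = image_mset snd g"

definition splits :: "('a \<times> 'a) multiset \<Rightarrow> nat \<Rightarrow> bool" where
  "splits b k \<longleftrightarrow> (\<exists>P. size P = k \<and> \<Sum>\<^sub># P = b \<and> (\<forall>g \<in># P. g \<noteq> {#} \<and> balanced g))"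

lemma splits_add: "splits b k \<Longrightarrow> g \<noteq> {#} \<Longrightarrow> balanced g \<Longrightarrow> splits (g + b) (Suc k)"
proof -
  assume "splits b k" and g: "g \<noteq> {#}" "balanced g"
  then obtain P where "size P = k" "\<Sum>\<^sub># P = b" "\<forall>g \<in># P. g \<noteq> {#} \<and> balanced g"
    by (auto simp: splits_def)
  with g show ?thesis unfolding splits_def by (intro exI[of _ "add_mset g P"]) auto
qed

lemma splitsE:
  assumes "splits b k" "p \<in># b"
  obtains g b' k' where "k = Suc k'" "b = g + b'" "p \<in># g" "g \<noteq> {#}" "balanced g" "splits b' k'"
proof -
  obtain P where P: "size P = k" "\<Sum>\<^sub># P = b" "\<forall>g \<in># P. g \<noteq> {#} \<and> balanced g"
    using assms by (auto simp: splits_def)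
  then obtain g where g: "g \<in># P" "p \<in># g" using assms(2) by auto
  then obtain P' where P': "P = add_mset g P'" by (metis insert_DiffM)
  then have "splits (\<Sum>\<^sub># P') (size P')" using P by (auto simp: splits_def)
  then show thesis using P P' g that[of "size P'" g "\<Sum>\<^sub># P'"] by auto
qed

lemma splits_size: "splits b k \<Longrightarrow> k \<le> size b"
proof (induction k arbitrary: b)
  case (Suc k)
  then have "b \<noteq> {#}" by (auto simp: splits_def)
  then obtain p where "p \<in># b" by blast
  then obtain g b' k' where *: "Suc k = Suc k'" "b = g + b'" "g \<noteq> {#}" "splits b' k'"
    using splitsE[OF Suc.prems] by metis
  moreover have "size g \<ge> 1" using * by (metis Suc_leI One_nat_def size_eq_0_iff_empty neq0_conv)
  ultimately show ?case using Suc.IH[of b'] by auto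
qed simp

lemma splits_diag: "(\<And>p. p \<in># b \<Longrightarrow> fst p = snd p) \<Longrightarrow> splits b (size b)"
proof (induction b)
  case (add p b)
  then have "splits b (size b)" "balanced {#p#}" by (auto simp: balanced_def)
  then show ?case using splits_add[of b "size b" "{#p#}"] by simp
qed (auto simp: splits_def)

text \<open>As many parts as pairs leaves room for singletons only, and a balanced singleton is
  diagonal.\<close>

lemma splits_full:
  assumes "splits b k" "size b \<le> k" "p \<in># b"
  shows "fst p = snd p"
proof -
  obtain g b' k' where *: "k = Suc k'" "b = g + b'" "p \<in># g" "balanced g" "splits b' k'"
    by (rule splitsE[OF assms(1,3)])
  then have "size g \<le> 1" using assms(2) splits_size[of b' k'] by auto
  moreover obtain g0 where g0: "g = add_mset p g0" using *(3) by (metis insert_DiffM)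
  ultimately have "g = {#p#}" by auto
  then show ?thesis using * by (simp add: balanced_def)
qed

lemma balanced_add: "balanced g \<Longrightarrow> balanced h \<Longrightarrow> balanced (g + h)"
  by (simp add: balanced_def)

text \<open>p and p' are the colours of two exchanged tokens; only the parts that contain them merge.\<close>
lemma splits_swap:
  assumes "splits (b + {#(p, q), (p', q')#}) k"
  shows "\<exists>k'. k \<le> Suc k' \<and> splits (b + {#(p', q), (p, q')#}) k'"
proof -
  obtain g r j where 1: "k = Suc j" "b + {#(p, q), (p', q')#} = g + r" "(p, q) \<in># g"
    "balanced g" "splits r j"
    by (rule splitsE[OF assms, of "(p, q)"]) auto
  obtain g0 where g0: "g = add_mset (p, q) g0" using 1(3) by (metis insert_DiffM)
  have e: "add_mset (p', q') b = g0 + r" using 1(2) unfolding g0 by simp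
  show ?thesis
  proof (cases "(p', q') \<in># g0")
    case True
    then obtain g1 where g1: "g0 = add_mset (p', q') g1" by (metis insert_DiffM)
    then have "b + {#(p', q), (p, q')#} = (g1 + {#(p', q), (p, q')#}) + r" using e by simp
    moreover have "balanced (g1 + {#(p', q), (p, q')#})"
      using 1(4) unfolding g0 g1 by (simp add: balanced_def add_mset_commute)
    ultimately have "splits (b + {#(p', q), (p, q')#}) k"
      using splits_add[OF 1(5), of "g1 + {#(p', q), (p, q')#}"] 1(1) by simp
    then show ?thesis by (intro exI[of _ k]) simp
  next
    case False
    then have "(p', q') \<in># r" using e by (metis union_iff union_single_eq_member)
    then obtain h r' j' where 2: "j = Suc j'" "r = h + r'" "(p', q') \<in># h" "balanced h" "splits r' j'"
      using splitsE[OF 1(5)] by metis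
    obtain h0 where h0: "h = add_mset (p', q') h0" using 2(3) by (metis insert_DiffM)
    have "b + {#(p', q), (p, q')#} = (g0 + h0 + {#(p', q), (p, q')#}) + r'"
      using e unfolding 2(2) h0 by simp
    moreover have "balanced (g0 + h0 + {#(p', q), (p, q')#})"
      using balanced_add[OF 1(4) 2(4)] unfolding g0 h0 by (simp add: balanced_def add_mset_commute)
    ultimately have "splits (b + {#(p', q), (p, q')#}) j"
      using splits_add[OF 2(5), of "g0 + h0 + {#(p', q), (p, q')#}"] 2(1) by simp
    then show ?thesis using 1(1) by auto
  qed
qed

section \<open>Swapping sequences against numbers of parts\<close>

definition pairs :: "nat list \<Rightarrow> nat list \<Rightarrow> (nat \<times> nat) multiset" where
  "pairs f f' = mset (zip f f')"

lemma pairs_image: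
  "length f = n \<Longrightarrow> length f' = n \<Longrightarrow> pairs f f' = image_mset (\<lambda>i. (f ! i, f' ! i)) (mset_set {0..<n})"
proof -
  assume "length f = n" "length f' = n"
  then have "zip f f' = map (\<lambda>i. (f ! i, f' ! i)) [0..<n]" by (auto intro: nth_equalityI)
  then show ?thesis by (simp add: pairs_def flip: mset_map mset_upt)
qed

lemma pairs_swap:
  assumes len: "length f = n" "length ft = n" "length f' = n" and uv: "u < n" "v < n" "u \<noteq> v"
    and f': "f' ! u = f ! v" "f' ! v = f ! u" "\<And>w. w < n \<Longrightarrow> w \<noteq> u \<Longrightarrow> w \<noteq> v \<Longrightarrow> f' ! w = f ! w"
  shows "\<exists>b. pairs f ft = b + {#(f ! u, ft ! u), (f ! v, ft ! v)#}
           \<and> pairs f' ft = b + {#(f ! v, ft ! u), (f ! u, ft ! v)#}"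
proof -
  let ?S = "{0..<n} - {u, v}"
  have S: "mset_set {0..<n} = add_mset u (add_mset v (mset_set ?S))"
  proof -
    have "{0..<n} = insert u (insert v ?S)" using uv by auto
    then have "mset_set {0..<n} = mset_set (insert u (insert v ?S))" by simp
    also have "\<dots> = add_mset u (add_mset v (mset_set ?S))" using uv by simp
    finally show ?thesis .
  qed
  have "image_mset (\<lambda>i. (f' ! i, ft ! i)) (mset_set ?S) = image_mset (\<lambda>i. (f ! i, ft ! i)) (mset_set ?S)"
    using f'(3) by (intro image_mset_cong) auto
  then show ?thesis
    unfolding pairs_image[OF len(1,2)] pairs_image[OF len(3,2)] S using f'(1,2) by simp
qed

text \<open>At the target all pairs are diagonal and form n singleton parts. Going back one swap
  loses at most one part by \<open>splits_swap\<close>, so at least n - j parts remain after j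
  swaps.\<close>

lemma relpow_splits:
  assumes "(f, ft) \<in> swap_rel n c E ^^ j" "length f = n" "length ft = n" "\<And>u. \<not> E u u"
  shows "\<exists>k. n \<le> j + k \<and> splits (pairs f ft) k"
  using assms
proof (induction j arbitrary: f)
  case 0
  then have "splits (pairs f ft) (size (pairs f ft))"
    by (intro splits_diag) (auto simp: pairs_def in_set_zip)
  then show ?case using 0 by (auto simp: pairs_def)
next
  case (Suc j)
  obtain f' where f': "(f, f') \<in> swap_rel n c E" "(f', ft) \<in> swap_rel n c E ^^ j"
    using Suc.prems(1) by (metis relpow_Suc_D2)
  from f'(1) obtain u v where uv: "length f' = n" "u < n" "v < n" "E u v" "f' ! u = f ! v" "f' ! v = f ! u"
    "\<And>w. w < n \<Longrightarrow> w \<noteq> u \<Longrightarrow> w \<noteq> v \<Longrightarrow> f' ! w = f ! w"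
    by (auto simp: swap_rel_def adjacent_placements_def token_placement_def)
  then have "u \<noteq> v" using Suc.prems(4) by auto
  then obtain b where b: "pairs f ft = b + {#(f ! u, ft ! u), (f ! v, ft ! v)#}"
      "pairs f' ft = b + {#(f ! v, ft ! u), (f ! u, ft ! v)#}"
    using pairs_swap[of f n ft f' u v] uv Suc.prems by auto
  obtain k where k: "n \<le> j + k" "splits (pairs f' ft) k"
    using Suc.IH[OF f'(2)] uv Suc.prems by auto
  from splits_swap[OF k(2)[unfolded b]] obtain k' where "k \<le> Suc k'" "splits (pairs f ft) k'"
    unfolding b by auto
  then show ?case using k(1) by (intro exI[of _ k']) auto
qed

text \<open>Greedy choice: some part contains a misplaced token of colour p at a vertex that wants
  q. Swapping it with a token of colour q from the same part makes (q, q) a part of its own and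
  keeps the rest balanced, so each swap gains a part.\<close>

lemma splits_relpow:
  assumes "splits (pairs f ft) k" "n \<le> j + k" "token_placement n c f" "token_placement n c ft"
  shows "\<exists>i \<le> j. (f, ft) \<in> swap_rel n c complete_graph ^^ i"
  using assms
proof (induction j arbitrary: f k)
  case 0
  have len: "length f = n" "length ft = n" using 0 by (auto simp: token_placement_def)
  have "f = ft"
  proof (rule nth_equalityI)
    fix i assume "i < length f"
    then have "(f ! i, ft ! i) \<in># pairs f ft" using len by (auto simp: pairs_def set_zip)
    then show "f ! i = ft ! i"
      using splits_full[OF 0(1)] 0(2) len by (fastforce simp: pairs_def)
  qed (use len in simp)
  then show ?case by auto
next
  case (Suc j)
  have len: "length f = n" "length ft = n" using Suc by (auto simp: token_placement_def)
  show ?case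
  proof (cases "n \<le> j + k")
    case True
    then show ?thesis using Suc.IH[OF Suc.prems(1) True Suc.prems(3,4)] by (meson le_SucI)
  next
    case False
    show ?thesis
    proof (cases "f = ft")
      case True
      then have "(f, ft) \<in> swap_rel n c complete_graph ^^ 0" by simp
      then show ?thesis by blast
    next
      case False
      then obtain v where v: "v < n" "f ! v \<noteq> ft ! v" using len by (auto simp: list_eq_iff_nth_eq)
      then have "(f ! v, ft ! v) \<in># pairs f ft" using len by (auto simp: pairs_def set_zip)
      then obtain g b' k' where g: "k = Suc k'" "pairs f ft = g + b'" "(f ! v, ft ! v) \<in># g"
        "balanced g" "splits b' k'" by (rule splitsE[OF Suc.prems(1)])
      \<comment> \<open>Balance supplies the partner: the wanted colour occurs as a second component
        of the part, hence also as a first one.\<close>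
      have "ft ! v \<in># image_mset snd g" using g(3) by force
      then have "ft ! v \<in># image_mset fst g" using g(4) by (simp add: balanced_def)
      then obtain r where r: "(ft ! v, r) \<in># g" by auto
      let ?p = "f ! v" and ?q = "ft ! v"
      obtain g0 where g0: "g = add_mset (?p, ?q) (add_mset (?q, r) g0)"
      proof -
      from g(3) obtain g1 where g1: "g = add_mset (?p, ?q) g1" by (metis insert_DiffM)
      then have "(?q, r) \<in># g1" using r v(2) by auto
      then obtain g0 where "g1 = add_mset (?q, r) g0" by (metis insert_DiffM)
      then show thesis using that g1 by blast
    qed
      \<comment> \<open>Any vertex with this pair will do, since parts are multisets of pairs and
        not sets of vertices. It differs from \<open>v\<close> because its colour does.\<close>
      have "(?q, r) \<in># pairs f ft" using r g(2) by simp
      then obtain u where u: "u < n" "f ! u = ?q" "ft ! u = r"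
        using len by (auto simp: pairs_def set_zip)
      then have uv: "u \<noteq> v" using v by auto
      define f' where "f' = f[v := f ! u, u := f ! v]"
      have f'n: "length f' = n" "f' ! u = f ! v" "f' ! v = f ! u"
        "\<And>w. w < n \<Longrightarrow> w \<noteq> u \<Longrightarrow> w \<noteq> v \<Longrightarrow> f' ! w = f ! w"
        using uv u(1) v(1) len by (auto simp: f'_def nth_list_update)
      have "mset f' = mset f" unfolding f'_def using uv u(1) v(1) len by (simp add: mset_swap)
      then have tp: "token_placement n c f'"
        using Suc.prems(3) f'n(1) by (metis token_placement_def set_mset_mset)
      have "f' \<noteq> f" using f'n(3) u(2) v(2) by metis
      then have adj: "(f, f') \<in> swap_rel n c complete_graph"
        unfolding swap_rel_def adjacent_placements_def complete_graph_def
        using Suc.prems(3) tp uv u(1) v(1) f'n by blast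
      obtain b where b: "pairs f ft = b + {#(f ! u, ft ! u), (f ! v, ft ! v)#}"
          "pairs f' ft = b + {#(f ! v, ft ! u), (f ! u, ft ! v)#}"
        using pairs_swap[of f n ft f' u v] f'n uv u v len by auto
      have "b = g0 + b'" using b(1) g(2) unfolding g0 u(2,3) by (simp add: add_mset_commute)
      then have "pairs f' ft = {#(?q, ?q)#} + ((g0 + {#(?p, r)#}) + b')"
        unfolding b(2) u(2,3) by simp
      moreover have "balanced (g0 + {#(?p, r)#})"
        using g(4) unfolding g0 by (simp add: balanced_def add_mset_commute)
      then have "splits ((g0 + {#(?p, r)#}) + b') k"
        using splits_add[OF g(5), of "g0 + {#(?p, r)#}"] g(1) by simp
      ultimately have "splits (pairs f' ft) (Suc k)"
        using splits_add[of "(g0 + {#(?p, r)#}) + b'" k "{#(?q, ?q)#}"] by (simp add: balanced_def)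
      moreover have "n \<le> j + Suc k" using Suc.prems(2) by simp
      ultimately obtain i where "i \<le> j" "(f', ft) \<in> swap_rel n c complete_graph ^^ i"
        using Suc.IH[OF _ _ tp Suc.prems(4)] by blast
      then have "Suc i \<le> Suc j" "(f, ft) \<in> swap_rel n c complete_graph ^^ Suc i"
        using adj relpow_Suc_I2 by auto
      then show ?thesis by blast
    qed
  qed
qed

text \<open>A finite infimum rules out the empty index set, and a nonempty set of extended naturals
  attains its infimum.\<close>

lemma INF_enat_le_iff: "(INF k \<in> A. enat k) \<le> enat l \<longleftrightarrow> (\<exists>k \<in> A. k \<le> l)"
proof
  assume L: "(INF k \<in> A. enat k) \<le> enat l"
  then have "A \<noteq> {}" by (auto simp: top_enat_def)
  then have "enat ` A \<noteq> {}" by simp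
  then have "(INF k \<in> A. enat k) \<in> enat ` A"
    by (metis Inf_enat_def LeastI ex_in_conv)
  with L show "\<exists>k \<in> A. k \<le> l" by auto
qed (meson INF_lower2 enat_ord_simps(1))

theorem OPT_le_iff_splits:
  assumes "token_placement n c f" "token_placement n c ft"
  shows "OPT n c complete_graph f ft \<le> enat l \<longleftrightarrow> (\<exists>k. n \<le> l + k \<and> splits (pairs f ft) k)"
proof
  assume "OPT n c complete_graph f ft \<le> enat l"
  then obtain j where j: "j \<le> l" "(f, ft) \<in> swap_rel n c complete_graph ^^ j"
    by (auto simp: OPT_def INF_enat_le_iff)
  from relpow_splits[OF j(2)] assms obtain k where "n \<le> j + k" "splits (pairs f ft) k"
    by (auto simp: token_placement_def complete_graph_def)
  then show "\<exists>k. n \<le> l + k \<and> splits (pairs f ft) k" using j(1) by (intro exI[of _ k]) auto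
next
  assume "\<exists>k. n \<le> l + k \<and> splits (pairs f ft) k"
  then show "OPT n c complete_graph f ft \<le> enat l"
    using splits_relpow[OF _ _ assms] assms(1) by (auto simp: OPT_def INF_enat_le_iff)
qed

section \<open>The dynamic program\<close>

lemma sigma_cycle:
  fixes \<sigma> :: "'a \<Rightarrow> 'a"
  assumes "finite X" "X \<noteq> {}" "\<sigma> ` X \<subseteq> X"
  shows "\<exists>Y \<subseteq> X. Y \<noteq> {} \<and> \<sigma> ` Y = Y"
  using assms
proof (induction "card X" arbitrary: X rule: less_induct)
  case less
  show ?case
  proof (cases "\<sigma> ` X = X")
    case False
    \<comment> \<open>Iterated images shrink strictly until they are stable, and on the stable set
      the map is onto.\<close>
    then have "\<sigma> ` X \<subset> X" using less.prems(3) by blast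
    then have "card (\<sigma> ` X) < card X" using less.prems(1) by (simp add: psubset_card_mono)
    then obtain Y where "Y \<subseteq> \<sigma> ` X" "Y \<noteq> {}" "\<sigma> ` Y = Y"
      using less.hyps[of "\<sigma> ` X"] less.prems by (meson finite_imageI image_is_empty image_mono)
    then show ?thesis using less.prems(3) by (metis order_trans)
  next
    case True
    then show ?thesis using less.prems(2) by (intro exI[of _ X]) auto
  qed
qed

text \<open>Choose one outgoing arc for every colour that occurs; balance makes its head such a
  colour again. On a stable set the choice \<sigma> is a permutation, and its graph is a balanced
  set of arcs.\<close>

lemma balanced_has_simple:
  assumes "balanced g" "g \<noteq> {#}"
  shows "\<exists>h. h \<noteq> {#} \<and> h \<subseteq># g \<and> balanced h \<and> (\<forall>p. count h p \<le> 1)"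
proof -
  define X where "X = fst ` set_mset g"
  have snd: "snd ` set_mset g = X"
    using assms(1) unfolding X_def balanced_def by (metis set_image_mset)
  have "\<forall>i \<in> X. \<exists>j. (i, j) \<in># g" by (auto simp: X_def)
  then obtain \<sigma> where \<sigma>: "\<And>i. i \<in> X \<Longrightarrow> (i, \<sigma> i) \<in># g" by metis
  then have "\<sigma> ` X \<subseteq> X" using snd by force
  then obtain Y where Y: "Y \<subseteq> X" "Y \<noteq> {}" "\<sigma> ` Y = Y"
    using sigma_cycle[of X \<sigma>] assms(2) by (auto simp: X_def)
  have fin: "finite Y" using Y by (auto simp: X_def intro: finite_subset)
  have inj: "inj_on \<sigma> Y" using Y(3) fin by (simp add: eq_card_imp_inj_on)
  define h where "h = mset_set ((\<lambda>i. (i, \<sigma> i)) ` Y)"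
  have h: "h = image_mset (\<lambda>i. (i, \<sigma> i)) (mset_set Y)"
    by (simp add: h_def image_mset_mset_set inj_on_def)
  have "balanced h"
    unfolding balanced_def h using inj Y(3) by (simp add: image_mset.compositionality o_def image_mset_mset_set)
  moreover have "h \<noteq> {#}" using Y fin by (simp add: h mset_set_empty_iff)
  moreover have "count h p \<le> 1" for p by (simp add: h_def count_mset_set')
  moreover have "h \<subseteq># g"
  proof (rule mset_subset_eqI)
    fix p
    show "count h p \<le> count g p"
      using \<sigma> Y(1) by (auto simp: h_def count_mset_set' Suc_le_eq)
  qed
  ultimately show ?thesis by blast
qed

definition simple_parts :: "('a \<times> 'a) multiset multiset \<Rightarrow> bool" where
  "simple_parts P \<longleftrightarrow> (\<forall>g \<in># P. g \<noteq> {#} \<and> balanced g \<and> (\<forall>p. count g p \<le> 1))"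

lemma balanced_simple_parts: "balanced g \<Longrightarrow> \<exists>P. \<Sum>\<^sub># P = g \<and> simple_parts P"
proof (induction "size g" arbitrary: g rule: less_induct)
  case less
  show ?case
  proof (cases "g = {#}")
    case False
    then obtain h where h: "h \<noteq> {#}" "h \<subseteq># g" "balanced h" "\<forall>p. count h p \<le> 1"
      using balanced_has_simple less.prems by blast
    then obtain g' where g': "g = h + g'" by (metis subset_mset.le_iff_add)
    then have "balanced g'" using less.prems h(3) by (simp add: balanced_def)
    moreover have "size g' < size g" using h(1) g' by (simp add: nonempty_has_size)
    ultimately obtain P where "\<Sum>\<^sub># P = g'" "simple_parts P" using less.hyps by blast
    then show ?thesis using h g' by (intro exI[of _ "add_mset h P"]) (auto simp: simple_parts_def)
  next
    case True
    then have "\<Sum>\<^sub># {#} = g \<and> simple_parts {#}" by (simp add: simple_parts_def)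
    then show ?thesis by blast
  qed
qed

text \<open>Refining a nonempty part yields at least one simple part, so the count never drops and
  only simple parts need to be scheduled.\<close>

lemma splits_simple_parts:
  assumes "splits b k"
  shows "\<exists>P. k \<le> size P \<and> \<Sum>\<^sub># P = b \<and> simple_parts P"
proof -
  obtain Q where Q: "size Q = k" "\<Sum>\<^sub># Q = b" "\<forall>g \<in># Q. g \<noteq> {#} \<and> balanced g"
    using assms by (auto simp: splits_def)
  from Q(3) have "\<exists>P. size Q \<le> size P \<and> \<Sum>\<^sub># P = \<Sum>\<^sub># Q \<and> simple_parts P"
  proof (induction Q)
    case (add g Q)
    then obtain P where P: "size Q \<le> size P" "\<Sum>\<^sub># P = \<Sum>\<^sub># Q" "simple_parts P" by auto
    obtain R where R: "\<Sum>\<^sub># R = g" "simple_parts R" using add.prems balanced_simple_parts by force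
    then have "R \<noteq> {#}" using add.prems by auto
    then have "1 \<le> size R" by (simp add: Suc_leI nonempty_has_size)
    then show ?case using P R by (intro exI[of _ "R + P"]) (auto simp: simple_parts_def)
  next
    case empty
    show ?case by (intro exI[of _ "{#}"]) (simp add: simple_parts_def)
  qed
  then show ?thesis using Q by simp
qed

section \<open>Digit sums and carries\<close>

definition digit_sum :: "nat \<Rightarrow> nat \<Rightarrow> nat \<Rightarrow> nat" where
  "digit_sum b k x = (\<Sum>a<k. x div b ^ a mod b)"

lemma digit_sum_Suc: "digit_sum b (Suc k) x = x mod b + digit_sum b k (x div b)"
  unfolding digit_sum_def by (subst sum.lessThan_Suc_shift) (simp add: div_mult2_eq)

lemma digit_sum_0 [simp]: "digit_sum b k 0 = 0"
  by (simp add: digit_sum_def)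

lemma digit_sum_1: "2 \<le> b \<Longrightarrow> digit_sum b k 1 \<le> 1"
  by (cases k) (simp_all add: digit_sum_Suc, simp add: digit_sum_def)

lemma add_carry:
  fixes x y b :: nat
  assumes "0 < b"
  shows "x mod b + y mod b < b \<Longrightarrow> (x + y) mod b = x mod b + y mod b \<and> (x + y) div b = x div b + y div b"
    and "b \<le> x mod b + y mod b \<Longrightarrow> (x + y) mod b + b = x mod b + y mod b \<and> (x + y) div b = x div b + y div b + 1"
proof -
  have e: "x + y = (x mod b + y mod b) + (x div b + y div b) * b"
    using div_mult_mod_eq[of x b] div_mult_mod_eq[of y b] by (simp add: algebra_simps)
  have d: "(x + y) mod b = (x mod b + y mod b) mod b"
    "(x + y) div b = (x div b + y div b) + (x mod b + y mod b) div b"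
    using assms by (simp_all add: mod_add_eq, subst e, simp)
  show "x mod b + y mod b < b \<Longrightarrow> (x + y) mod b = x mod b + y mod b \<and> (x + y) div b = x div b + y div b"
    using d by simp
  assume c: "b \<le> x mod b + y mod b"
  have "x mod b < b" "y mod b < b" using assms by auto
  then have lt: "x mod b + y mod b - b < b" by linarith
  have "(x mod b + y mod b) mod b = x mod b + y mod b - b" "(x mod b + y mod b) div b = 1"
    using c lt assms by (simp_all add: le_mod_geq le_div_geq)
  then show "(x + y) mod b + b = x mod b + y mod b \<and> (x + y) div b = x div b + y div b + 1"
    using d c by simp
qed

text \<open>A carry trades \<open>b\<close> units of one digit for a single unit of the next. The
  program cannot divide and so never sees a digit; comparing tabulated digit sums is its way of
  detecting carries.\<close>

lemma digit_sum_add_le: "2 \<le> b \<Longrightarrow> digit_sum b k (x + y) \<le> digit_sum b k x + digit_sum b k y"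
proof (induction k arbitrary: x y)
  case (Suc k)
  show ?case
  proof (cases "x mod b + y mod b < b")
    case True
    then show ?thesis using add_carry(1)[of b x y] Suc.IH[of "x div b" "y div b"] Suc.prems
      by (simp add: digit_sum_Suc)
  next
    case False
    then show ?thesis
      using add_carry(2)[of b x y] Suc.IH[of "x div b" "y div b"] Suc.IH[of "x div b + y div b" 1]
        digit_sum_1[of b k] Suc.prems
      by (simp add: digit_sum_Suc)
  qed
qed (simp add: digit_sum_def)

text \<open>Every carry lowers the digit sum by b - 1, so additivity of the digit sum means that no carry
  occurs.\<close>
lemma digit_sum_add_eq:
  assumes "2 \<le> b" "digit_sum b k (x + y) = digit_sum b k x + digit_sum b k y" "a < k"
  shows "(x + y) div b ^ a mod b = x div b ^ a mod b + y div b ^ a mod b"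
  using assms
proof (induction k arbitrary: x y a)
  case (Suc k)
  show ?case
  proof (cases "x mod b + y mod b < b")
    case True
    have c: "(x + y) mod b = x mod b + y mod b" "(x + y) div b = x div b + y div b"
      using add_carry(1)[OF _ True] Suc.prems(1) by auto
    show ?thesis
    proof (cases a)
      case 0
      then show ?thesis using c by simp
    next
      case (Suc a')
      have "digit_sum b k (x div b + y div b) = digit_sum b k (x div b) + digit_sum b k (y div b)"
        using Suc.prems(2) c by (simp add: digit_sum_Suc)
      from Suc.IH[OF Suc.prems(1) this, of a'] show ?thesis
        using Suc.prems(3) c Suc by (simp add: div_mult2_eq)
    qed
  next
    case False
    then have "digit_sum b (Suc k) (x + y) < digit_sum b (Suc k) x + digit_sum b (Suc k) y"
      using add_carry(2)[of b x y] digit_sum_add_le[of b k "x div b" "y div b"]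
        digit_sum_add_le[of b k "x div b + y div b" 1] digit_sum_1[of b k] Suc.prems(1)
      by (simp add: digit_sum_Suc)
    then show ?thesis using Suc.prems(2) by simp
  qed
qed simp

lemma sum_digits: "(\<Sum>a<k. (x div b ^ a mod b) * b ^ a) = x mod b ^ (k :: nat)" for x b :: nat
proof (induction k)
  case (Suc k)
  have "x mod b ^ Suc k = b ^ k * (x div b ^ k mod b) + x mod b ^ k"
    using mod_mult2_eq[of x "b ^ k" b] by (simp add: mult.commute)
  then show ?case using Suc by simp
qed simp

lemma digits_sum:
  fixes d :: "nat \<Rightarrow> nat"
  assumes "\<And>a. d a < b"
  shows "(\<Sum>a<k. d a * b ^ a) < b ^ k \<and> (\<forall>a<k. (\<Sum>a<k. d a * b ^ a) div b ^ a mod b = d a)"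
proof (induction k)
  case (Suc k)
  let ?s = "\<Sum>a<k. d a * b ^ a"
  have b: "0 < b" using assms[of 0] by simp
  have "?s + d k * b ^ k < b ^ k + d k * b ^ k" using Suc by simp
  also have "\<dots> = (d k + 1) * b ^ k" by simp
  also have "\<dots> \<le> b * b ^ k" using assms[of k] by (intro mult_right_mono) auto
  finally have 1: "?s + d k * b ^ k < b ^ Suc k" by simp
  have "(?s + d k * b ^ k) div b ^ a mod b = d a" if "a < Suc k" for a
  proof (cases "a = k")
    case True
    then show ?thesis using Suc b assms[of k] by simp
  next
    case False
    then have "a < k" using that by simp
    then obtain j where j: "k = a + Suc j" using less_iff_Suc_add by auto
    have "d k * b ^ k = (d k * b ^ j * b) * b ^ a"
      unfolding j by (simp add: power_add algebra_simps)
    then have "(?s + d k * b ^ k) div b ^ a = (?s + (d k * b ^ j * b) * b ^ a) div b ^ a" by (simp only:)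
    also have "\<dots> = d k * b ^ j * b + ?s div b ^ a" using b by (subst div_mult_self1) auto
    finally have "(?s + d k * b ^ k) div b ^ a = d k * b ^ j * b + ?s div b ^ a" .
    then show ?thesis using Suc \<open>a < k\<close> by simp
  qed
  then show ?case using 1 by simp
qed simp

section \<open>Numbers as codes of multisets of colour pairs\<close>

locale codes =
  fixes c :: nat and M :: nat
  assumes c: "1 \<le> c" and M: "2 \<le> M"
begin

definition "m = c * c"
definition "Z = M ^ m"
definition "arc a = (a div c + 1, a mod c + 1)" for a :: nat
definition "idx p = (fst p - 1) * c + (snd p - 1)" for p :: "nat \<times> nat"
definition "dg x a = x div M ^ a mod M" for x a :: nat
definition "dec x = (\<Sum>a<m. replicate_mset (dg x a) (arc a))" for x :: nat
definition "enc g = (\<Sum>a<m. count g (arc a) * M ^ a)" for g :: "(nat \<times> nat) multiset"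
definition "arcs = {1..c} \<times> {1..c}"

lemma arc_idx: "p \<in> arcs \<Longrightarrow> idx p < m \<and> arc (idx p) = p"
proof -
  assume p: "p \<in> arcs"
  obtain i j where ij: "p = (Suc i, Suc j)" "i < c" "j < c"
    using p unfolding arcs_def by (metis Suc_le_eq Suc_pred' atLeastAtMost_iff less_eq_Suc_le mem_Sigma_iff One_nat_def surj_pair)
  have "i * c + j < (i + 1) * c" using ij by simp
  also have "\<dots> \<le> c * c" using ij by (intro mult_right_mono) auto
  finally show ?thesis using ij by (simp add: idx_def arc_def m_def)
qed

lemma arc_in: "a < m \<Longrightarrow> arc a \<in> arcs"
  using c by (auto simp: arc_def arcs_def m_def Suc_le_eq less_mult_imp_div_less)

lemma idx_arc: "idx (arc a) = a"
  by (simp add: idx_def arc_def)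

lemma arc_inj: "arc a = arc a' \<longleftrightarrow> a = a'"
  by (metis idx_arc)

lemma count_dec_arc: "a < m \<Longrightarrow> count (dec x) (arc a) = dg x a"
  by (simp add: dec_def count_sum arc_inj if_distrib cong: if_cong)

lemma set_dec: "set_mset (dec x) \<subseteq> arcs"
proof -
  have "count (dec x) p = 0" if "p \<notin> arcs" for p
    using that arc_in by (auto simp: dec_def count_sum)
  then show ?thesis by (metis count_eq_zero_iff subsetI)
qed

lemma multiset_arcs_eqI:
  assumes "set_mset g \<subseteq> arcs" "set_mset h \<subseteq> arcs" "\<And>a. a < m \<Longrightarrow> count g (arc a) = count h (arc a)"
  shows "g = h"
proof (rule multiset_eqI)
  fix p
  show "count g p = count h p"
  proof (cases "p \<in> arcs")
    case True
    then show ?thesis using arc_idx assms(3) by metis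
  next
    case False
    then show ?thesis using assms(1,2) by (metis count_eq_zero_iff subsetD)
  qed
qed

lemma size_dec: "size (dec x) = digit_sum M m x"
proof -
  have "size (\<Sum>a<k. replicate_mset (dg x a) (arc a)) = digit_sum M k x" for k
    by (induction k) (auto simp: digit_sum_def dg_def)
  then show ?thesis by (simp add: dec_def)
qed

lemma enc_dec: "x < Z \<Longrightarrow> enc (dec x) = x"
  using sum_digits[of x M m] by (simp add: enc_def count_dec_arc dg_def Z_def)

lemma dec_enc:
  assumes "set_mset g \<subseteq> arcs" "\<And>p. count g p < M"
  shows "enc g < Z" "dec (enc g) = g"
proof -
  have d: "enc g < M ^ m \<and> (\<forall>a<m. enc g div M ^ a mod M = count g (arc a))"
    using digits_sum[of "\<lambda>a. count g (arc a)" M m] assms(2) unfolding enc_def by blast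
  then show "enc g < Z" by (simp add: Z_def)
  show "dec (enc g) = g"
    using d assms(1) set_dec by (intro multiset_arcs_eqI) (auto simp: count_dec_arc dg_def)
qed

lemma enc_add: "enc (g + h) = enc g + enc h"
  by (simp add: enc_def sum.distrib algebra_simps)

text \<open>The form used for soundness: the hypothesis is the very comparison that the program
  makes at run time.\<close>

lemma dec_plus:
  assumes "size (dec (x + y)) = size (dec x) + size (dec y)"
  shows "dec (x + y) = dec x + dec y"
proof (rule multiset_arcs_eqI)
  fix a assume "a < m"
  then show "count (dec (x + y)) (arc a) = count (dec x + dec y) (arc a)"
    using digit_sum_add_eq[OF M, of m x y a] assms by (simp add: count_dec_arc dg_def size_dec)
qed (use set_dec in auto)

text \<open>The form used for completeness: room in every digit guarantees that the run-time
  comparison succeeds.\<close>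

lemma dec_plus_small:
  assumes "x < Z" "y < Z" "\<And>p. count (dec x) p + count (dec y) p < M"
  shows "x + y < Z" "dec (x + y) = dec x + dec y"
proof -
  have "enc (dec x + dec y) = x + y" using assms by (simp add: enc_add enc_dec)
  then show "x + y < Z" "dec (x + y) = dec x + dec y"
    using dec_enc[of "dec x + dec y"] set_dec assms(3) by (metis (no_types, lifting) count_union le_sup_iff set_mset_union)+
qed

lemma dec_0: "dec 0 = {#}"
  by (simp add: dec_def dg_def)

lemma enc_single: "a < m \<Longrightarrow> enc {#arc a#} = M ^ a"
proof -
  assume a: "a < m"
  have "enc {#arc a#} = (\<Sum>a'<m. if a' = a then M ^ a' else 0)"
    unfolding enc_def by (intro sum.cong) (auto simp: arc_inj)
  then show ?thesis using a by simp
qed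

lemma dec_power: "a < m \<Longrightarrow> M ^ a < Z \<and> dec (M ^ a) = {#arc a#}"
  using dec_enc[of "{#arc a#}"] arc_in M by (simp add: enc_single)

lemma dec_add_power:
  assumes "a < m" "x + M ^ a < M ^ Suc a"
  shows "dec (x + M ^ a) = add_mset (arc a) (dec x)"
proof -
  have "M ^ Suc a \<le> Z" unfolding Z_def using assms(1) M by (intro power_increasing) auto
  then have x: "x < Z" using assms(2) by simp
  have "Suc (x div M ^ a) = (x + M ^ a) div M ^ a" using M by simp
  also have "\<dots> < M" using assms(2) by (simp add: less_mult_imp_div_less)
  finally have "Suc (x div M ^ a) < M" .
  then have "Suc (dg x a) < M" by (simp add: dg_def)
  moreover have "count (dec x) p < M" for p
  proof (cases "p \<in> arcs")
    case True
    then show ?thesis using arc_idx[OF True] count_dec_arc[of "idx p" x] M by (simp add: dg_def)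
  next
    case False
    then have "count (dec x) p = 0" using set_dec by (metis count_eq_zero_iff subsetD)
    then show ?thesis using M by simp
  qed
  ultimately have "count (dec x) p + count (dec (M ^ a)) p < M" for p
    using count_dec_arc[OF assms(1), of x] dec_power[OF assms(1)] by auto
  then show ?thesis using dec_plus_small(2)[OF x, of "M ^ a"] dec_power[OF assms(1)] by simp
qed

text \<open>Every left-over has to absorb the new token, so the old value at \<open>y\<close> is
  discarded; the equation between sizes excludes carries.\<close>

definition "shift W B = (\<lambda>y. if y < Z
   then (if W \<le> y \<and> size (dec (y - W)) + 1 = size (dec y) then B (y - W) else 0) else B y)"
  for W :: nat and B :: "nat \<Rightarrow> nat"

text \<open>Splitting off a part is optional, in contrast to feeding in a token, so the old value
  stays in competition through \<open>max\<close>.\<close>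

definition "relax g B = (if balanced (dec g)
   then (\<lambda>x. if x + g < Z \<and> size (dec x) + size (dec g) = size (dec (x + g))
             then max (B x) (if B (x + g) = 0 then 0 else B (x + g) + 1) else B x)
   else B)" for g :: nat and B :: "nat \<Rightarrow> nat"

text \<open>Each code is offered once per round, since no kind falls due twice in a round. Code 0 is
  omitted: the empty multiset is not a part.\<close>

definition "relax_all B = fold relax [1..<Z] B"

text \<open>One visit of a vertex feeds in one n-th of its pair, and \<open>n\<close> visits to
  pairs of the same type make a token. The counter thereby computes
  \<open>t * count b p div n\<close> without dividing.\<close>

definition "tok n a s = (if n \<le> fst s a + 1 then ((fst s)(a := 0), shift (M ^ a) (snd s))
   else ((fst s)(a := fst s a + 1), snd s))" for n a :: nat and s :: "(nat \<Rightarrow> nat) \<times> (nat \<Rightarrow> nat)"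

definition "rnd n as s = (let s' = fold (tok n) as s in (fst s', relax_all (snd s')))"

definition "start = ((\<lambda>_. 0, (\<lambda>_. 0)(0 := 1)) :: (nat \<Rightarrow> nat) \<times> (nat \<Rightarrow> nat))"

text \<open>In a table entry 0 stands for an unreachable code, and k + 1 for k parts split off.\<close>

definition "sound e B \<longleftrightarrow> (\<forall>y<Z. B y \<noteq> 0 \<longrightarrow> (\<exists>r k. B y = Suc k \<and> e = dec y + r \<and> splits r k))"
definition "covers B o' k \<longleftrightarrow> (\<exists>y<Z. dec y = o' \<and> k < B y)" for B :: "nat \<Rightarrow> nat" and k :: nat

lemma sound_shift:
  assumes "sound e B" "a < m"
  shows "sound (add_mset (arc a) e) (shift (M ^ a) B)"
  unfolding sound_def
proof (intro allI impI)
  fix y assume y: "y < Z" "shift (M ^ a) B y \<noteq> 0"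
  then have s: "M ^ a \<le> y" "size (dec (y - M ^ a)) + 1 = size (dec y)" "shift (M ^ a) B y = B (y - M ^ a)"
    by (auto simp: shift_def split: if_splits)
  then obtain r k where "B (y - M ^ a) = Suc k" "e = dec (y - M ^ a) + r" "splits r k"
    using assms(1) y unfolding sound_def by (metis less_imp_diff_less)
  moreover have "dec y = dec (y - M ^ a) + {#arc a#}"
    using dec_plus[of "y - M ^ a" "M ^ a"] s dec_power[OF assms(2)] by simp
  ultimately show "\<exists>r k. shift (M ^ a) B y = Suc k \<and> add_mset (arc a) e = dec y + r \<and> splits r k"
    using s(3) by auto
qed

lemma sound_relax:
  assumes "sound e B" "0 < g"
  shows "sound e (relax g B)"
proof (cases "balanced (dec g)")
  case True
  show ?thesis
    unfolding sound_def
  proof (intro allI impI)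
    fix x assume x: "x < Z" "relax g B x \<noteq> 0"
    show "\<exists>r k. relax g B x = Suc k \<and> e = dec x + r \<and> splits r k"
    proof (cases "relax g B x = B x")
      case True
      then show ?thesis using x assms(1) by (auto simp: sound_def)
    next
      case False
      then have *: "x + g < Z" "size (dec x) + size (dec g) = size (dec (x + g))" "B (x + g) \<noteq> 0"
        "relax g B x = Suc (B (x + g))"
        using True by (auto simp: relax_def max_def split: if_splits)
      obtain r k where r: "B (x + g) = Suc k" "e = dec (x + g) + r" "splits r k"
        using assms(1) *(1,3) by (auto simp: sound_def)
      have "dec g \<noteq> {#}"
        using enc_dec[of g] enc_dec[of 0] *(1) assms(2) dec_0 by auto
      then have "splits (dec g + r) (Suc k)" using splits_add[OF r(3)] True by blast
      moreover have "e = dec x + (dec g + r)" using r(2) dec_plus[of x g] *(2) by simp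
      ultimately show ?thesis using *(4) r(1) by auto
    qed
  qed
qed (use assms in \<open>simp add: relax_def\<close>)

lemma sound_relax_all: "sound e B \<Longrightarrow> sound e (relax_all B)"
proof -
  assume "sound e B"
  then have "sound e (fold relax L B)" if "0 \<notin> set L" for L
    using that by (induction L arbitrary: B) (auto simp: sound_relax)
  then show ?thesis by (simp add: relax_all_def)
qed

lemma covers_shift:
  assumes "covers B o' k" "a < m" "\<And>p. count (add_mset (arc a) o') p < M"
  shows "covers (shift (M ^ a) B) (add_mset (arc a) o') k"
proof -
  obtain y where y: "y < Z" "dec y = o'" "k < B y" using assms(1) by (auto simp: covers_def)
  have "count (dec y) p + count (dec (M ^ a)) p < M" for p
    using assms(3)[of p] y(2) dec_power[OF assms(2)] by (cases "arc a = p") auto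
  then have "y + M ^ a < Z" "dec (y + M ^ a) = dec y + {#arc a#}"
    using dec_plus_small[OF y(1), of "M ^ a"] dec_power[OF assms(2)] by auto
  then show ?thesis
    using y unfolding covers_def by (intro exI[of _ "y + M ^ a"]) (auto simp: shift_def)
qed

lemma covers_relax: "covers B o' k \<Longrightarrow> covers (relax g B) o' k"
  unfolding covers_def relax_def by (auto simp: less_max_iff_disj)

lemma covers_relax_part:
  assumes "covers B (o' + dec g) k" "balanced (dec g)" "g < Z" "\<And>p. count (o' + dec g) p < M"
  shows "covers (relax g B) o' (Suc k)"
proof -
  obtain y where y: "y < Z" "dec y = o' + dec g" "k < B y" using assms(1) by (auto simp: covers_def)
  have "set_mset o' \<subseteq> arcs" using set_dec[of y] y(2) by auto
  moreover have "count o' p < M" for p using assms(4)[of p] by simp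
  ultimately have x: "enc o' < Z" "dec (enc o') = o'" using dec_enc by auto
  have "y = enc o' + g" using enc_dec[OF y(1)] enc_dec[OF assms(3)] y(2) by (simp add: enc_add)
  then show ?thesis
    using x y assms(2) unfolding covers_def
    by (intro exI[of _ "enc o'"]) (auto simp: relax_def less_max_iff_disj)
qed

text \<open>\<open>D\<close> holds the codes due in this round. The pass splits each of them off
  when it meets it and ignores the others; the sum of those still to come belongs to the left-over,
  so the digit bound at the start covers all later states.\<close>

lemma covers_fold_relax:
  assumes "covers B (o' + (\<Sum>j \<in> set L \<inter> D. dec j)) k" "distinct L"
    "\<And>j. j \<in> D \<Longrightarrow> balanced (dec j) \<and> j < Z"
    "\<And>p. count (o' + (\<Sum>j \<in> set L \<inter> D. dec j)) p < M"
  shows "covers (fold relax L B) o' (k + card (set L \<inter> D))"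
  using assms
proof (induction L arbitrary: B k)
  case (Cons j L)
  show ?case
  proof (cases "j \<in> D")
    case False
    then have "set (j # L) \<inter> D = set L \<inter> D" by auto
    then show ?thesis using Cons covers_relax by simp
  next
    case True
    let ?r = "o' + (\<Sum>j \<in> set L \<inter> D. dec j)"
    have e: "set (j # L) \<inter> D = insert j (set L \<inter> D)" using True by auto
    have j: "j \<notin> set L \<inter> D" using Cons.prems by auto
    have s: "o' + (\<Sum>j \<in> set (j # L) \<inter> D. dec j) = ?r + dec j"
      unfolding e using j by (simp add: add_ac)
    have "covers (relax j B) ?r (Suc k)"
      using covers_relax_part[of B ?r j k] Cons.prems True unfolding s by auto
    moreover have "count ?r p < M" for p using Cons.prems(4)[of p] unfolding s by simp
    ultimately have "covers (fold relax L (relax j B)) o' (Suc k + card (set L \<inter> D))"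
      using Cons.IH[of "relax j B" "Suc k"] Cons.prems by simp
    then show ?thesis unfolding e using j by simp
  qed
qed simp

lemma covers_relax_all:
  assumes "covers B (o' + (\<Sum>g \<in> D. g)) k" "finite D"
    "\<And>g. g \<in> D \<Longrightarrow> balanced g \<and> g \<noteq> {#} \<and> set_mset g \<subseteq> arcs"
    "\<And>p. count (o' + (\<Sum>g \<in> D. g)) p < M"
  shows "covers (relax_all B) o' (k + card D)"
proof -
  have cnt: "count g p < M" if "g \<in> D" for g p
  proof -
    have "count g p \<le> (\<Sum>g \<in> D. count g p)" using that assms(2) by (intro member_le_sum) auto
    then show ?thesis using assms(4)[of p] by (simp add: count_sum)
  qed
  have dec: "dec (enc g) = g" "enc g < Z" "enc g \<noteq> 0" if "g \<in> D" for g
    using dec_enc[of g] cnt that assms(3)[OF that] dec_0 by metis+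
  have inj: "inj_on enc D" by (metis dec(1) inj_onI)
  have e: "set [1..<Z] \<inter> enc ` D = enc ` D" using dec by fastforce
  have s: "(\<Sum>j \<in> enc ` D. dec j) = (\<Sum>g \<in> D. g)"
    using inj dec(1) by (simp add: sum.reindex)
  have "covers (fold relax [1..<Z] B) o' (k + card (enc ` D))"
  proof -
    have "covers B (o' + (\<Sum>j \<in> set [1..<Z] \<inter> enc ` D. dec j)) k"
      "count (o' + (\<Sum>j \<in> set [1..<Z] \<inter> enc ` D. dec j)) p < M" for p
      unfolding e s by (fact assms)+
    then show ?thesis
      using covers_fold_relax[of B o' "[1..<Z]" "enc ` D" k] dec assms(3) unfolding e by fastforce
  qed
  then show ?thesis using inj by (simp add: card_image relax_all_def)
qed

end

section \<open>The proportional schedule\<close>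

lemma sum_mset_repeat:
  assumes "finite S" "set_mset P \<subseteq> S"
  shows "\<Sum>\<^sub># P = (\<Sum>g\<in>S. repeat_mset (count P g) g)"
  using assms(2)
proof (induction P)
  case (add h P)
  have "(\<Sum>g\<in>S. repeat_mset (count (add_mset h P) g) g)
      = (\<Sum>g\<in>S. repeat_mset (count P g) g + (if g = h then h else {#}))"
    by (intro sum.cong) (auto intro: multiset_eqI)
  also have "\<dots> = \<Sum>\<^sub># P + h" using add assms(1) by (simp add: sum.distrib)
  finally show ?case by (simp add: add.commute)
qed simp

lemma count_le_size: "count A x \<le> size A"
  by (induction A) auto

text \<open>Superadditivity of the floor. With \<open>x g\<close> the multiplicity of the kind
  \<open>g\<close> and \<open>k g\<close> its number of arcs of one type: no more is split off than
  has been fed in.\<close>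

lemma interleave_lower:
  fixes x k :: "'a \<Rightarrow> nat"
  assumes "0 < n"
  shows "(\<Sum>g\<in>G. (t * x g div n) * k g) \<le> t * (\<Sum>g\<in>G. x g * k g) div n"
proof -
  have "(\<Sum>g\<in>G. (t * x g div n) * k g) * n = (\<Sum>g\<in>G. ((t * x g div n) * n) * k g)"
    by (simp add: sum_distrib_left sum_distrib_right mult_ac)
  also have "\<dots> \<le> (\<Sum>g\<in>G. (t * x g) * k g)"
    by (intro sum_mono mult_right_mono) auto
  also have "\<dots> = t * (\<Sum>g\<in>G. x g * k g)" by (simp add: sum_distrib_left mult_ac)
  finally show ?thesis using assms by (simp add: less_eq_div_iff_mult_less_eq)
qed

text \<open>Each floor loses less than 1 and enters with a coefficient of at most 1, which is where
  simplicity of the parts is used.\<close>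

lemma interleave_upper:
  fixes x k :: "'a \<Rightarrow> nat"
  assumes "0 < n" "\<And>g. g \<in> G \<Longrightarrow> k g \<le> 1"
  shows "t * (\<Sum>g\<in>G. x g * k g) div n \<le> (\<Sum>g\<in>G. (t * x g div n) * k g) + card G"
proof -
  have "t * (\<Sum>g\<in>G. x g * k g) = (\<Sum>g\<in>G. (t * x g) * k g)"
    by (simp add: sum_distrib_left mult_ac)
  also have "\<dots> \<le> (\<Sum>g\<in>G. n * ((t * x g div n) * k g) + n)"
  proof (rule sum_mono)
    fix g assume "g \<in> G"
    then have k: "k g = 0 \<or> k g = 1" using assms(2) by (auto simp: le_Suc_eq)
    have "t * x g \<le> n * (t * x g div n) + n"
      using mult_div_mod_eq[of n "t * x g"] mod_less_divisor[OF assms(1), of "t * x g"] by linarith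
    then show "t * x g * k g \<le> n * ((t * x g div n) * k g) + n" using k by auto
  qed
  also have "\<dots> = n * ((\<Sum>g\<in>G. (t * x g div n) * k g) + card G)"
    by (simp add: sum.distrib sum_distrib_left algebra_simps)
  finally have "t * (\<Sum>g\<in>G. x g * k g) div n
      \<le> n * ((\<Sum>g\<in>G. (t * x g div n) * k g) + card G) div n" by (rule div_le_mono)
  then show ?thesis using assms(1) by simp
qed

lemma div_add_le: "0 < n \<Longrightarrow> x \<le> n \<Longrightarrow> (y + x) div n \<le> y div n + (1 :: nat)"
  using div_le_mono[of "y + x" "y + n" n] by simp

lemma div_mod_Suc:
  fixes q n :: nat
  assumes "0 < n"
  shows "n \<le> q mod n + 1 \<Longrightarrow> Suc q div n = q div n + 1 \<and> Suc q mod n = 0"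
    and "\<not> n \<le> q mod n + 1 \<Longrightarrow> Suc q div n = q div n \<and> Suc q mod n = q mod n + 1"
proof -
  show "n \<le> q mod n + 1 \<Longrightarrow> Suc q div n = q div n + 1 \<and> Suc q mod n = 0"
    using mod_less_divisor[OF assms, of q] by (auto simp: div_Suc mod_Suc)
  show "\<not> n \<le> q mod n + 1 \<Longrightarrow> Suc q div n = q div n \<and> Suc q mod n = q mod n + 1"
    by (auto simp: div_Suc mod_Suc)
qed

section \<open>Correctness of the dynamic program\<close>

context codes
begin

text \<open>q p is n times the amount of p fed in so far, X the sum of the k parts split off by the
  schedule; C says that a schedule to follow exists at all.\<close>

definition "loop_inv n q X k C s \<longleftrightarrow> (\<exists>e. (\<forall>p. count e p = q p div n)
    \<and> (\<forall>p\<in>arcs. fst s (idx p) = q p mod n) \<and> sound e (snd s)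
    \<and> (C \<longrightarrow> (\<exists>o'. e = o' + X \<and> covers (snd s) o' k)))"
  for n :: nat and q :: "nat \<times> nat \<Rightarrow> nat" and X :: "(nat \<times> nat) multiset" and k :: nat and C :: bool
    and s :: "(nat \<Rightarrow> nat) \<times> (nat \<Rightarrow> nat)"

lemma idx_inj: "p \<in> arcs \<Longrightarrow> p' \<in> arcs \<Longrightarrow> idx p = idx p' \<longleftrightarrow> p = p'"
  using arc_idx by metis

lemma inv_tok:
  assumes inv: "loop_inv n q X k C s" and p0: "p0 \<in> arcs" and n: "0 < n"
    and win: "\<And>p. C \<Longrightarrow> (q(p0 := Suc (q p0))) p div n < M + count X p"
  shows "loop_inv n (q(p0 := Suc (q p0))) X k C (tok n (idx p0) s)"
proof -
  obtain e where e: "\<forall>p. count e p = q p div n" "\<forall>p\<in>arcs. fst s (idx p) = q p mod n" "sound e (snd s)"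
    "C \<longrightarrow> (\<exists>o'. e = o' + X \<and> covers (snd s) o' k)"
    using inv unfolding loop_inv_def by blast
  have i: "idx p0 < m" "arc (idx p0) = p0" using arc_idx[OF p0] by auto
  show ?thesis
  proof (cases "n \<le> q p0 mod n + 1")
    case True
    note d = div_mod_Suc(1)[OF n True]
    have s: "tok n (idx p0) s = ((fst s)(idx p0 := 0), shift (M ^ idx p0) (snd s))"
      using True e(2) p0 by (simp add: tok_def)
    let ?e = "add_mset p0 e"
    have cnt: "\<forall>p. count ?e p = (q(p0 := Suc (q p0))) p div n" using d e(1) by (auto simp del: split_paired_All)
    moreover have "\<forall>p\<in>arcs. fst (tok n (idx p0) s) (idx p) = (q(p0 := Suc (q p0))) p mod n"
      using d e(2) p0 by (auto simp: s idx_inj)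
    moreover have "sound ?e (snd (tok n (idx p0) s))"
      using sound_shift[OF e(3) i(1)] i(2) by (simp add: s)
    moreover have "\<exists>o'. ?e = o' + X \<and> covers (snd (tok n (idx p0) s)) o' k" if C
    proof -
      obtain o' where o': "e = o' + X" "covers (snd s) o' k" using e(4) \<open>C\<close> by blast
      have "count (add_mset p0 o') p < M" for p
      proof -
        have "count ?e p = count (add_mset p0 o') p + count X p" using o'(1) by simp
        then show ?thesis using win[OF that, of p] cnt by (metis add.commute add_less_cancel_left)
      qed
      then have "covers (shift (M ^ idx p0) (snd s)) (add_mset p0 o') k"
        using covers_shift[OF o'(2) i(1)] i(2) by simp
      then show ?thesis using o'(1) by (intro exI[of _ "add_mset p0 o'"]) (simp add: s)
    qed
    ultimately show ?thesis unfolding loop_inv_def by blast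
  next
    case False
    note d = div_mod_Suc(2)[OF n False]
    have s: "tok n (idx p0) s = ((fst s)(idx p0 := fst s (idx p0) + 1), snd s)"
      using False e(2) p0 by (simp add: tok_def)
    have "\<forall>p. count e p = (q(p0 := Suc (q p0))) p div n" using d e(1) by (auto simp del: split_paired_All)
    moreover have "\<forall>p\<in>arcs. fst (tok n (idx p0) s) (idx p) = (q(p0 := Suc (q p0))) p mod n"
      using d e(2) p0 by (auto simp: s idx_inj)
    ultimately show ?thesis using e(3,4) unfolding loop_inv_def s by (intro exI[of _ e]) (simp del: split_paired_All)
  qed
qed

lemma inv_fold_tok:
  assumes "loop_inv n q X k C s" "set ps \<subseteq> arcs" "0 < n"
    "\<And>p. C \<Longrightarrow> (q p + count (mset ps) p) div n < M + count X p"
  shows "loop_inv n (\<lambda>p. q p + count (mset ps) p) X k C (fold (tok n) (map idx ps) s)"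
  using assms
proof (induction ps arbitrary: q s)
  case (Cons p0 ps)
  let ?q = "q(p0 := Suc (q p0))"
  have q: "?q p + count (mset ps) p = q p + count (mset (p0 # ps)) p" for p by simp
  have "?q p div n < M + count X p" if C for p
  proof -
    have "?q p div n \<le> (?q p + count (mset ps) p) div n" by (intro div_le_mono) simp
    then show ?thesis using Cons.prems(4)[OF that, of p] unfolding q by simp
  qed
  then have "loop_inv n ?q X k C (tok n (idx p0) s)"
    using inv_tok[OF Cons.prems(1) _ Cons.prems(3)] Cons.prems(2) by simp
  from Cons.IH[OF this _ Cons.prems(3)] Cons.prems(2,4)
  have "loop_inv n (\<lambda>p. ?q p + count (mset ps) p) X k C (fold (tok n) (map idx ps) (tok n (idx p0) s))"
    unfolding q by simp
  then show ?case unfolding q by simp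
qed simp

lemma inv_relax:
  assumes inv: "loop_inv n q X k C s"
    and win: "\<And>p. C \<Longrightarrow> q p div n < M + count X p"
    and D: "C \<Longrightarrow> finite D" "\<And>g. C \<Longrightarrow> g \<in> D \<Longrightarrow> balanced g \<and> g \<noteq> {#} \<and> set_mset g \<subseteq> arcs"
    and X': "\<And>p. C \<Longrightarrow> count (X + \<Sum>D) p \<le> q p div n"
  shows "loop_inv n q (X + \<Sum>D) (k + card D) C (fst s, relax_all (snd s))"
proof -
  obtain e where e: "\<forall>p. count e p = q p div n" "\<forall>p\<in>arcs. fst s (idx p) = q p mod n" "sound e (snd s)"
    "C \<longrightarrow> (\<exists>o'. e = o' + X \<and> covers (snd s) o' k)"
    using inv unfolding loop_inv_def by blast
  have "\<exists>o'. e = o' + (X + \<Sum>D) \<and> covers (relax_all (snd s)) o' (k + card D)" if C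
  proof -
    obtain o' where o': "e = o' + X" "covers (snd s) o' k" using e(4) \<open>C\<close> by blast
    have ce: "count e p = count o' p + count X p" for p using o'(1) by simp
    \<comment> \<open>Here the lower bound of the schedule enters: the parts that are due fit into
      the current left-over.\<close>
    have "\<Sum>D \<subseteq># o'"
    proof (rule mset_subset_eqI)
      fix p
      show "count (\<Sum>D) p \<le> count o' p" using X'[OF that, of p] spec[OF e(1), of p] ce[of p] by simp
    qed
    then obtain o'' where o'': "o' = o'' + \<Sum>D" by (metis add.commute subset_mset.le_iff_add)
    have "count o' p < M" for p using win[OF that, of p] spec[OF e(1), of p] ce[of p] by simp
    then have "covers (relax_all (snd s)) o'' (k + card D)"
      using covers_relax_all[of "snd s" o'' D k] o'(2) D that unfolding o'' by blast
    then show ?thesis using o'(1) o'' by (intro exI[of _ o'']) (simp add: add_ac)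
  qed
  then show ?thesis
    using e(1,2) sound_relax_all[OF e(3)] unfolding loop_inv_def by (intro exI[of _ e]) (simp del: split_paired_All)
qed

text \<open>A simple part is determined by its support, a subset of the m arcs.\<close>

lemma card_simple_parts:
  assumes "simple_parts P" "set_mset (\<Sum>\<^sub># P) \<subseteq> arcs"
  shows "card (set_mset P) \<le> 2 ^ m"
proof -
  have "inj_on set_mset (set_mset P)"
  proof (rule inj_onI)
    fix g h assume gh: "g \<in># P" "h \<in># P" "set_mset g = set_mset h"
    show "g = h"
    proof (rule multiset_eqI)
      fix p
      have "count g p \<le> 1" "count h p \<le> 1" using gh assms(1) unfolding simple_parts_def by blast+
      moreover have "count g p = 0 \<longleftrightarrow> count h p = 0" using gh(3) by (metis count_eq_zero_iff)
      ultimately show "count g p = count h p" by linarith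
    qed
  qed
  then have "card (set_mset P) = card (set_mset ` set_mset P)" by (simp add: card_image)
  also have "\<dots> \<le> card (Pow arcs)"
  proof (intro card_mono)
    show "finite (Pow arcs)" by (simp add: arcs_def)
    show "set_mset ` set_mset P \<subseteq> Pow arcs" using assms(2) by auto
  qed
  also have "\<dots> = 2 ^ m" by (simp add: card_Pow arcs_def m_def)
  finally show ?thesis .
qed

definition "dp n as = snd ((rnd n as ^^ n) start) 0"

text \<open>Soundness holds for every base because carries are detected; \<open>M_big\<close>
  ensures that the left-overs of the schedule are representable. The 1 in \<open>n + 1\<close>
  offsets the shift by one in the table entries.\<close>

theorem dp_correct:
  assumes M_big: "2 ^ m + 2 \<le> M" and ps: "set ps \<subseteq> arcs" "length ps = n" and n: "0 < n"
  shows "(\<exists>k. n \<le> l + k \<and> splits (mset ps) k)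
     \<longleftrightarrow> dp n (map idx ps) \<noteq> 0 \<and> n + 1 \<le> l + dp n (map idx ps)"
proof -
  define b where "b = mset ps"
  \<comment> \<open>One induction serves both directions: soundness is unconditional, while
    completeness is guarded by \<open>C\<close>. Soundness can thus be read off with the dummy
    \<open>P = {#}\<close>.\<close>
  have main: "\<exists>e. e = b \<and> sound e (snd ((rnd n (map idx ps) ^^ n) start)) \<and>
      (simple_parts P \<and> \<Sum>\<^sub># P = b \<longrightarrow> covers (snd ((rnd n (map idx ps) ^^ n) start)) {#} (size P))" for P
  proof -
    define C where "C \<longleftrightarrow> simple_parts P \<and> \<Sum>\<^sub># P = b"
    define G where "G = set_mset P"
    define x where "x = (\<lambda>t g. t * count P g div n)"
    define X where "X = (\<lambda>t. \<Sum>g\<in>G. repeat_mset (x t g) g)"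
    have cX: "count (X t) p = (\<Sum>g\<in>G. x t g * count g p)" for t p
      by (simp add: X_def count_sum)
    have finG: "finite G" by (simp add: G_def)
    have bG: "count b p = (\<Sum>g\<in>G. count P g * count g p)" if C for p
    proof -
      have "b = (\<Sum>g\<in>G. repeat_mset (count P g) g)"
        using sum_mset_repeat[OF finG, of P] that unfolding C_def G_def by (metis order_refl)
      then show ?thesis by (simp add: count_sum)
    qed
    have arcsb: "set_mset b \<subseteq> arcs" using ps(1) by (simp add: b_def)
    have cardG: "card G \<le> 2 ^ m" if C
      using card_simple_parts[of P] arcsb that unfolding C_def G_def by metis
    have cb: "count b p \<le> n" for p using count_le_size[of b p] ps(2) by (simp add: b_def)
    \<comment> \<open>Multiplicities of at most \<open>n\<close> let \<open>x\<close> grow by at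
      most one per round, so the parts that fall due form a set.\<close>
    have cP: "count P g \<le> n" if C for g
    proof (cases "g \<in># P")
      case True
      then have "g \<noteq> {#}" using that by (auto simp: C_def simple_parts_def)
      then obtain p where p: "p \<in># g" by blast
      have "count P g \<le> count P g * count g p" using p by simp
      also have "\<dots> \<le> count b p"
        unfolding bG[OF that] using True finG by (intro member_le_sum) (auto simp: G_def)
      finally show ?thesis using cb[of p] by simp
    qed (simp add: not_in_iff)
    have low: "count (X t) p \<le> t * count b p div n" if C for t p
      unfolding cX bG[OF that] x_def by (rule interleave_lower[OF n])
    have up: "t * count b p div n \<le> count (X t) p + card G" if C for t p
      unfolding cX bG[OF that] x_def
      using that by (intro interleave_upper[OF n]) (auto simp: G_def C_def simple_parts_def simp del: split_paired_All)
    have "loop_inv n (\<lambda>p. t * count b p) (X t) (\<Sum>g\<in>G. x t g) C ((rnd n (map idx ps) ^^ t) start)" for t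
    proof (induction t)
      case 0
      have "covers (snd start) {#} 0"
        using dec_0 M by (auto simp: covers_def start_def Z_def intro!: exI[of _ 0])
      moreover have "sound {#} (snd start)"
        using dec_0 by (auto simp: sound_def start_def splits_def)
      ultimately show ?case
        unfolding loop_inv_def by (intro exI[of _ "{#}"]) (simp add: start_def X_def x_def)
    next
      case (Suc t)
      let ?s = "(rnd n (map idx ps) ^^ t) start"
      let ?s' = "fold (tok n) (map idx ps) ?s"
      define D where "D = {g \<in> G. x (Suc t) g \<noteq> x t g}"
      have xS: "x (Suc t) g = x t g + (if g \<in> D then 1 else 0)" if C "g \<in> G" for g
      proof -
        have "x t g \<le> x (Suc t) g" unfolding x_def by (intro div_le_mono) simp
        moreover have "x (Suc t) g \<le> x t g + 1"
          using div_add_le[OF n cP[OF that(1), of g], of "t * count P g"] by (simp add: x_def add.commute)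
        ultimately show ?thesis using that(2) by (auto simp: D_def)
      qed
      have DG: "D \<subseteq> G" "finite D" using finG by (auto simp: D_def)
      have XS: "X (Suc t) = X t + \<Sum>D" if C
      proof -
        have "X (Suc t) = (\<Sum>g\<in>G. repeat_mset (x t g) g + (if g \<in> D then g else {#}))"
          unfolding X_def by (intro sum.cong) (auto simp: xS[OF that] intro: multiset_eqI)
        also have "\<dots> = X t + (\<Sum>g\<in>G \<inter> D. g)"
          using finG by (simp add: sum.distrib X_def sum.inter_restrict)
        finally show ?thesis using DG by (simp add: Int_absorb1)
      qed
      have kS: "(\<Sum>g\<in>G. x (Suc t) g) = (\<Sum>g\<in>G. x t g) + card D" if C
      proof -
        have "(\<Sum>g\<in>G. x (Suc t) g) = (\<Sum>g\<in>G. x t g + (if g \<in> D then 1 else 0))"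
          by (intro sum.cong) (auto simp: xS[OF that])
        also have "\<dots> = (\<Sum>g\<in>G. x t g) + card (G \<inter> D)"
          using finG by (simp add: sum.distrib flip: sum.inter_restrict)
        finally show ?thesis using DG by (simp add: Int_absorb1)
      qed
      \<comment> \<open>Before the round at most \<open>2 ^ m\<close> tokens of a type are left
        over, and \<open>count b p \<le> n\<close> limits the new ones to one. This is the origin of
        \<open>2 ^ m + 2 \<le> M\<close>.\<close>
      have win: "(t * count b p + count b p) div n < M + count (X t) p" if C for p
        using div_add_le[OF n cb, of "t * count b p" p] up[OF that, of t p] cardG[OF that] M_big by linarith
      have "loop_inv n (\<lambda>p. t * count b p + count b p) (X t) (\<Sum>g\<in>G. x t g) C ?s'"
        using inv_fold_tok[OF Suc ps(1) n] win by (simp add: b_def)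
      then have "loop_inv n (\<lambda>p. t * count b p + count b p) (X t + \<Sum>D) ((\<Sum>g\<in>G. x t g) + card D) C
         (fst ?s', relax_all (snd ?s'))"
      proof (rule inv_relax)
        fix g assume Cg: C "g \<in> D"
        then have "g \<in># P" using DG by (auto simp: G_def)
        then show "balanced g \<and> g \<noteq> {#} \<and> set_mset g \<subseteq> arcs"
          using Cg(1) arcsb by (auto simp: C_def simple_parts_def)
      next
        fix p assume C
        then show "count (X t + \<Sum>D) p \<le> (t * count b p + count b p) div n"
          using low[of "Suc t" p] XS by (simp add: add.commute)
      qed (use win DG in auto)
      then have "loop_inv n (\<lambda>p. Suc t * count b p) (X t + \<Sum>D) ((\<Sum>g\<in>G. x t g) + card D) C
         ((rnd n (map idx ps) ^^ Suc t) start)"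
        by (simp add: rnd_def Let_def add.commute)
      then show ?case unfolding loop_inv_def using XS kS by metis
    qed
    from this[of n] obtain e where e: "\<forall>p. count e p = count b p" "sound e (snd ((rnd n (map idx ps) ^^ n) start))"
      "C \<longrightarrow> (\<exists>o'. e = o' + X n \<and> covers (snd ((rnd n (map idx ps) ^^ n) start)) o' (\<Sum>g\<in>G. x n g))"
      using n unfolding loop_inv_def by auto
    have eb: "e = b" using e(1) by (intro multiset_eqI) blast
    \<comment> \<open>After \<open>n\<close> rounds no rounding remains: all of \<open>b\<close> is
      fed in, all of \<open>P\<close> is split off, and the left-over is empty.\<close>
    have xn: "x n g = count P g" for g using n by (simp add: x_def)
    have "X n = b" if C
      using sum_mset_repeat[OF finG, of P] that by (simp add: X_def xn C_def G_def)
    moreover have "(\<Sum>g\<in>G. x n g) = size P" by (simp add: xn G_def size_multiset_overloaded_eq)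
    ultimately show ?thesis using e eb by (auto simp: C_def)
  qed
  have Z0: "0 < Z" using M by (simp add: Z_def)
  show ?thesis
  proof
    assume "\<exists>k. n \<le> l + k \<and> splits (mset ps) k"
    then obtain k where k: "n \<le> l + k" "splits b k" by (auto simp: b_def)
    then obtain P where P: "k \<le> size P" "\<Sum>\<^sub># P = b" "simple_parts P" using splits_simple_parts by blast
    then have "covers (snd ((rnd n (map idx ps) ^^ n) start)) {#} (size P)" using main[of P] by blast
    then obtain y where "y < Z" "dec y = {#}" "size P < snd ((rnd n (map idx ps) ^^ n) start) y"
      by (auto simp: covers_def)
    moreover from this have "y = 0" using enc_dec[of y] enc_dec[OF Z0] dec_0 by simp
    ultimately show "dp n (map idx ps) \<noteq> 0 \<and> n + 1 \<le> l + dp n (map idx ps)"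
      using k P by (simp add: dp_def)
  next
    assume r: "dp n (map idx ps) \<noteq> 0 \<and> n + 1 \<le> l + dp n (map idx ps)"
    have "sound b (snd ((rnd n (map idx ps) ^^ n) start))" using main[of "{#}"] by blast
    then obtain r' k where "dp n (map idx ps) = Suc k" "b = dec 0 + r'" "splits r' k"
      using r Z0 unfolding sound_def dp_def by blast
    then show "\<exists>k. n \<le> l + k \<and> splits (mset ps) k" using r by (intro exI[of _ k]) (auto simp: dec_0 b_def)
  qed
qed

end

section \<open>The program\<close>

text \<open>Products and powers of two are computed by loops; as simplification rules, this lemma
  and the next ones evaluate them without an invariant.\<close>

lemma wp_loop_add [simp]:
  assumes "v x \<le> N" "r \<noteq> x" "r \<noteq> y"
  shows "wp N (Loop x (Plus r r y)) Q (v, a) = Q (v(r := v r + v x * v y), a)"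
proof -
  have "(sem (Plus r r y) ^^ j) (v, a) = (v(r := v r + j * v y), a)" for j
    using assms by (induction j) (auto simp: fun_eq_iff)
  then show ?thesis using assms by (simp add: wp_def)
qed

lemma sem_loop_double: "(sem (Plus r r r) ^^ j) (v, a) = (v(r := v r * 2 ^ j), a)"
  by (induction j) (auto simp: fun_eq_iff)

lemma wp_loop_double [simp]:
  assumes "v x \<le> N"
  shows "wp N (Loop x (Plus r r r)) Q (v, a) = Q (v(r := v r * 2 ^ v x), a)"
  using assms by (simp add: wp_def sem_loop_double)

lemma wp_loop_double2 [simp]:
  assumes "v x \<le> N" "v y \<le> N" "r \<noteq> x" "r \<noteq> y"
  shows "wp N (Loop x (Loop y (Plus r r r))) Q (v, a) = Q (v(r := v r * 2 ^ (v y * v x)), a)"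
proof -
  have "(sem (Loop y (Plus r r r)) ^^ j) (v, a) = (v(r := v r * 2 ^ (v y * j)), a)" for j
    using assms by (induction j) (auto simp: fun_eq_iff sem_loop_double power_add)
  note it = this
  have "sem (Loop x (Loop y (Plus r r r))) (v, a) = (v(r := v r * 2 ^ (v y * v x)), a)"
    by (subst sem.simps(7)) (simp only: it fst_conv)
  moreover have "safe N (Loop x (Loop y (Plus r r r))) (v, a)"
    using assms by (simp only: safe.simps it fst_conv) simp
  ultimately show ?thesis by (simp only: wp_def simp_thms)
qed

text \<open>Array 0 holds the input (c, l, f0, ft), 7 the digit sums, 2 and 3 the colour weights of
  the first and second components, 4 and 5 the code and the fraction fed in for each pair of colours
  (i, j) at index i * c + j, and 6 the table of the dynamic program. Tests are the 0/1 values 1 - (x - y),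
  and a loop iterating a 0/1 variable is a conditional.\<close>

definition "relax_code =
  Get 40 7 35 ;; Const 41 0 ;;
  Loop 9 (Plus 42 41 35 ;; Get 43 7 42 ;; Get 44 7 41 ;; Plus 44 44 40 ;;
    Minus 45 43 44 ;; Minus 46 44 43 ;; Plus 45 45 46 ;; Minus 45 3 45 ;;
    Get 46 6 42 ;; Minus 47 3 46 ;; Minus 47 3 47 ;; Plus 46 46 47 ;;
    Get 48 6 41 ;; Minus 46 46 48 ;; Loop 45 (Plus 48 48 46) ;; Put 6 41 48 ;; Plus 41 41 3)"

definition "relax_all_code =
  Const 35 1 ;;
  Loop 21 (Get 36 2 35 ;; Get 37 3 35 ;; Minus 38 36 37 ;; Minus 39 37 36 ;; Plus 38 38 39 ;;
    Minus 38 3 38 ;; Loop 38 relax_code ;; Plus 35 35 3)"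

definition "shift_code =
  Const 28 0 ;; Plus 28 28 9 ;;
  Loop 9 (Minus 28 28 3 ;; Minus 29 28 11 ;; Get 30 7 29 ;; Plus 30 30 3 ;; Get 31 7 28 ;;
    Minus 32 30 31 ;; Minus 33 31 30 ;; Plus 32 32 33 ;; Minus 33 11 28 ;; Plus 32 32 33 ;;
    Minus 32 3 32 ;; Get 33 6 29 ;; Const 34 0 ;; Loop 32 (Plus 34 34 33) ;; Put 6 28 34)"

definition "tok_code =
  Get 24 0 22 ;; Get 25 0 23 ;; Plus 22 22 3 ;; Plus 23 23 3 ;; Loop 24 (Plus 25 25 4) ;;
  Get 26 5 25 ;; Plus 26 26 3 ;; Minus 27 6 26 ;; Minus 27 3 27 ;;
  Loop 27 (Const 26 0 ;; Get 11 4 25 ;; shift_code) ;; Put 5 25 26"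

definition "main_code =
  Const 10 0 ;; Put 6 10 3 ;; Minus 21 9 3 ;;
  Loop 6 (Const 22 2 ;; Plus 23 22 6 ;; Loop 6 tok_code ;; relax_all_code)"

text \<open>A zero entry at code 0 means that the colour frequencies of the two placements differ,
  so that no swapping sequence exists; it must be rejected even if
  \<open>n + 1 \<le> l\<close>.\<close>

definition "out_code =
  Const 10 0 ;; Get 49 6 10 ;; Plus 50 6 3 ;; Plus 51 5 49 ;; Minus 50 50 51 ;; Minus 0 3 50 ;;
  Minus 49 3 49 ;; Minus 0 0 49"

definition "fill_code =
  Const 17 0 ;;
  Loop 16 (Plus 18 17 11 ;; Get 19 7 17 ;; Plus 19 19 3 ;; Put 7 18 19 ;;
    Get 19 2 17 ;; Plus 19 19 12 ;; Put 2 18 19 ;;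
    Get 19 3 17 ;; Plus 19 19 14 ;; Put 3 18 19 ;; Plus 17 17 3)"

definition "arc_code =
  Put 4 13 11 ;; Plus 13 13 3 ;; Const 15 0 ;; Plus 15 15 11 ;; Loop 8 (Plus 15 15 15) ;;
  Minus 16 15 11 ;; fill_code ;; Const 11 0 ;; Plus 11 11 15 ;; Loop 7 (Loop 8 (Plus 14 14 14))"

definition "table_code =
  Const 11 1 ;; Const 12 1 ;; Plus 13 4 3 ;;
  Loop 4 (Const 14 1 ;; Loop 4 arc_code ;; Loop 7 (Loop 8 (Plus 12 12 12)))"

definition "init_code =
  Const 3 1 ;; Const 10 0 ;; Get 4 0 10 ;; Get 5 0 3 ;;
  Const 6 0 ;; Loop 2 (Plus 6 6 10 ;; Minus 10 3 10) ;;
  Const 7 0 ;; Loop 4 (Plus 7 7 4) ;; Const 10 2 ;; Plus 8 7 10 ;;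
  Const 9 1 ;; Loop 7 (Loop 8 (Plus 9 9 9))"

definition "swap_code = init_code ;; table_code ;; main_code ;; out_code"

section \<open>Verification of the dynamic program's code\<close>

lemma (in codes) wp_relax:
  assumes v: "v 3 = 1" "v 9 = Z" "v 35 = g" "0 < g" and N: "1 \<le> N" "Z \<le> N"
    and a: "\<forall>x<Z. a 7 x = size (dec x)" "\<forall>y\<ge>Z. a 6 y = 0" and bal: "balanced (dec g)" "g < Z"
  shows "wp N relax_code (\<lambda>s. snd s 6 = relax g (a 6)) (v, a)"
proof -
  \<comment> \<open>The index ascends, so the entry at \<open>x + g\<close> is read before it is
    overwritten. The program makes no test for \<open>x + g < Z\<close>: beyond \<open>Z\<close> the
    table is zero, and a zero source leaves the target as it is.\<close>
  let ?I = "\<lambda>j s. fst s 41 = j \<and> snd s 6 = (\<lambda>x. if x < j then relax g (a 6) x else a 6 x)"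
  show ?thesis
    unfolding relax_code_def
    apply simp
    apply (rule wp_loop[where n = Z and I = ?I])
    subgoal using v by simp
    subgoal using N by simp
    subgoal by simp
    subgoal premises p for j v' a'
    proof -
      have fr: "v' 3 = 1" "v' 9 = Z" "v' 35 = g" "v' 40 = a 7 g" "a' 7 = a 7"
        using p(3) v by (simp_all add: frame_def)
      have I: "v' 41 = j" "a' 6 = (\<lambda>x. if x < j then relax g (a 6) x else a 6 x)"
        using p(2) by simp_all
      have R: "relax g (a 6) j = (if j + g < Z \<and> a 7 j + a 7 g = a 7 (j + g)
         then max (a 6 j) (if a 6 (j + g) = 0 then 0 else a 6 (j + g) + 1) else a 6 j)"
        using a(1) bal p(1) by (auto simp: relax_def)
      \<comment> \<open>Adding a truncated difference yields the maximum, and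
        \<open>1 - (1 - B)\<close> is 1 exactly for a reachable entry \<open>B\<close>.\<close>
      have "a 6 j + (1 - (a 7 (j + g) - (a 7 j + a 7 g) + (a 7 j + a 7 g - a 7 (j + g))))
           * (a 6 (j + g) + (1 - (1 - a 6 (j + g))) - a 6 j) = relax g (a 6) j"
        using a(2) by (cases "j + g < Z") (auto simp: R)
      then show ?thesis
        using N v(4) by (auto simp: fr I fun_eq_iff less_Suc_eq)
    qed
    subgoal premises p for v' a'
    proof -
      have "relax g (a 6) x = a 6 x" if "\<not> x < Z" for x using that by (simp add: relax_def)
      then show ?thesis using p(1) by (auto simp: fun_eq_iff)
    qed
    done
qed

text \<open>The index descends so that the entry at \<open>y - W\<close> is still the old one. For
  \<open>y < W\<close> the truncated index is 0, but the summand \<open>W - y\<close> makes the test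
  fail.\<close>

lemma (in codes) wp_shift:
  assumes v: "v 3 = 1" "v 9 = Z" "v 11 = W" "0 < W" and N: "1 \<le> N" "Z \<le> N"
    and a: "\<forall>x<Z. a 7 x = size (dec x)"
  shows "wp N shift_code (\<lambda>s. snd s 6 = shift W (a 6)) (v, a)"
proof -
  let ?I = "\<lambda>j s. fst s 28 = Z - j \<and> snd s 6 = (\<lambda>y. if Z - j \<le> y then shift W (a 6) y else a 6 y)"
  show ?thesis
    unfolding shift_code_def
    apply simp
    apply (rule wp_loop[where n = Z and I = ?I])
    subgoal using v by simp
    subgoal using N by simp
    subgoal using v by (auto simp: fun_eq_iff shift_def)
    subgoal premises p for j v' a'
    proof -
      have fr: "v' 3 = 1" "v' 9 = Z" "v' 11 = W" "a' 7 = a 7"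
        using p(3) v by (simp_all add: frame_def)
      have I: "v' 28 = Z - j" "a' 6 = (\<lambda>y. if Z - j \<le> y then shift W (a 6) y else a 6 y)"
        using p(2) by simp_all
      define y where "y = Z - Suc j"
      have y: "Z - j - 1 = y" "Z - Suc j = y" "y < Z" "Z - j = Suc y" using p(1) by (auto simp: y_def)
      have R: "shift W (a 6) y = (if W \<le> y \<and> a 7 (y - W) + 1 = a 7 y then a 6 (y - W) else 0)"
        using a y(3) by (simp add: shift_def)
      have e: "(1 - (a 7 (y - W) + 1 - a 7 y + (a 7 y - (a 7 (y - W) + 1)) + (W - y)))
           * a 6 (y - W) = shift W (a 6) y"
        by (auto simp: R)
      have N1: "Suc 0 - t \<le> N" for t using N by simp
      have nW: "(Suc y \<le> y - W) = False" by simp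
      have u: "(\<lambda>x. if Suc y \<le> x then F x else G x)(y := F y) = (\<lambda>x. if y \<le> x then F x else G x)"
        for F G :: "nat \<Rightarrow> nat" by (auto simp: fun_eq_iff not_less_eq_eq)
      show ?thesis
        using N e u[of "shift W (a 6)" "a 6"] by (simp add: fr I y nW N1)
    qed
    subgoal by simp
    done
qed

text \<open>The offset \<open>c + 1\<close> arises because colours start at 1: the program addresses
  the pair (i, j) by \<open>i * c + j\<close>, which is \<open>idx (i, j) + c + 1\<close>.\<close>

definition (in codes) "ready n l fs gs s \<longleftrightarrow> fst s 3 = 1 \<and> fst s 4 = c \<and> fst s 5 = l \<and> fst s 6 = n \<and> fst s 9 = Z
   \<and> (\<forall>i<n. snd s 0 (2 + i) = fs ! i \<and> snd s 0 (2 + n + i) = gs ! i)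
   \<and> (\<forall>x<Z. snd s 7 x = size (dec x)) \<and> (\<forall>x<Z. snd s 2 x = snd s 3 x \<longleftrightarrow> balanced (dec x))
   \<and> (\<forall>i<m. snd s 4 (i + c + 1) = M ^ i)" for n l :: nat and fs gs :: "nat list" and s :: store

definition (in codes) "stores s t \<longleftrightarrow> (\<forall>i<m. snd s 5 (i + c + 1) = fst t i) \<and> snd s 6 = snd t
   \<and> (\<forall>y\<ge>Z. snd t y = 0)" for s :: store and t :: "(nat \<Rightarrow> nat) \<times> (nat \<Rightarrow> nat)"

lemma (in codes) wp_tok:
  assumes r: "ready n l fs gs (v, a)" and st: "stores (v, a) t"
    and v: "v 22 = 2 + i" "v 23 = 2 + n + i" "i < n"
    and p: "(fs ! i, gs ! i) \<in> arcs" and N: "1 \<le> N" "Z \<le> N" "c \<le> N"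
  shows "wp N tok_code (\<lambda>s. stores s (tok n (idx (fs ! i, gs ! i)) t) \<and> fst s 22 = 3 + i \<and> fst s 23 = 3 + n + i) (v, a)"
proof -
  let ?p = "(fs ! i, gs ! i)"
  have k: "gs ! i + fs ! i * c = idx ?p + c + 1"
  proof -
    obtain x y where "fs ! i = Suc x" "gs ! i = Suc y"
      using p by (metis SigmaE2 arcs_def atLeastAtMost_iff not0_implies_Suc not_one_le_zero)
    then show ?thesis by (simp add: idx_def)
  qed
  have im: "idx ?p < m" using arc_idx[OF p] by simp
  have fsN: "fs ! i \<le> N" using p N by (simp add: arcs_def)
  have W: "0 < M ^ idx ?p" using M by simp
  note rd = r[unfolded ready_def, simplified]
  note sd = st[unfolded stores_def, simplified]
  show ?thesis
    unfolding tok_code_def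
    using rd v fsN k im sd
    apply simp
    apply (rule wp_if[where b = "n \<le> fst t (idx ?p) + 1"])
    subgoal by auto
    subgoal using N by simp
    subgoal premises q
      apply simp
      apply (rule wp_mono)
       apply (rule wp_shift[where W = "M ^ idx ?p"])
      using q W N im
            apply (simp_all add: frame_def shift_code_def)
      apply (auto simp: stores_def tok_def shift_def)
      done
    subgoal premises q
      using q im by (auto simp: stores_def tok_def)
    done
qed

lemma ready_frame:
  assumes "codes.ready c M n l fs gs s" "frame cmd s s'" "codes c M"
    "\<forall>u\<in>{3, 4, 5, 6, 9}. \<not> writes_var cmd u" "\<forall>k\<in>{0, 2, 3, 4, 7}. \<not> writes_arr cmd k"
  shows "codes.ready c M n l fs gs s'"
  using assms by (simp add: codes.ready_def frame_def)

context codes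
begin

lemma relax_beyond: "Z \<le> y \<Longrightarrow> relax g B y = B y"
  by (simp add: relax_def)

lemma fold_relax_beyond: "Z \<le> y \<Longrightarrow> fold relax L B y = B y"
  by (induction L arbitrary: B) (auto simp: relax_beyond)

lemma wp_relax_all:
  assumes r: "ready n l fs gs (v, a)" and v: "v 21 = Z - 1" and a: "\<forall>y\<ge>Z. a 6 y = 0"
    and N: "1 \<le> N" "Z \<le> N"
  shows "wp N relax_all_code (\<lambda>s. snd s 6 = relax_all (a 6)) (v, a)"
proof -
  let ?I = "\<lambda>j s. fst s 35 = Suc j \<and> snd s 6 = fold relax [1..<Suc j] (a 6)"
  note rd = r[unfolded ready_def, simplified]
  show ?thesis
    unfolding relax_all_code_def
    apply simp
    apply (rule wp_loop[where n = "Z - 1" and I = ?I])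
    subgoal using v by simp
    subgoal using N by simp
    subgoal by simp
    subgoal premises p for j v' a'
    proof -
      let ?g = "Suc j"
      have g: "?g < Z" using p(1) by simp
      have fr: "v' 3 = 1" "v' 9 = Z" "a' 7 = a 7" "a' 2 = a 2" "a' 3 = a 3"
        using p(3) rd by (simp_all add: frame_def relax_code_def)
      have I: "v' 35 = ?g" "a' 6 = fold relax [1..<?g] (a 6)" using p(2) by simp_all
      have S: "fold relax [1..<Suc ?g] (a 6) = relax ?g (a' 6)" by (simp add: I)
      have bal: "a 2 ?g = a 3 ?g \<longleftrightarrow> balanced (dec ?g)" using rd g by simp
      show ?thesis
        apply (simp add: fr I del: upt_Suc)
        apply (rule wp_if[where b = "balanced (dec ?g)"])
        subgoal using bal by auto
        subgoal using N by simp
        subgoal premises b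
          apply (rule wp_mono)
           apply (rule wp_relax[where g = ?g])
          using b fr I g N a rd
                   apply (simp_all add: fold_relax_beyond frame_def relax_code_def del: upt_Suc)
          unfolding S[symmetric] I by simp
        subgoal premises b
          using b S I fr by (simp add: relax_def del: upt_Suc)
        done
    qed
    subgoal premises p for v' a'
    proof -
      have "Suc (Z - 1) = Z" using M by (simp add: Z_def)
      then show ?thesis using p(1) by (simp add: relax_all_def del: upt_Suc)
    qed
    done
qed

lemma wp_main:
  assumes r: "ready n l fs gs (v, a)" and a: "a 5 = (\<lambda>_. 0)" "a 6 = (\<lambda>_. 0)"
    and fs: "length fs = n" "length gs = n" "set (zip fs gs) \<subseteq> arcs"
    and N: "1 \<le> N" "Z \<le> N" "c \<le> N" "n \<le> N"
  shows "wp N main_code (\<lambda>s. snd s 6 0 = dp n (map idx (zip fs gs))) (v, a)"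
proof -
  let ?as = "map idx (zip fs gs)"
  let ?t = "\<lambda>t. (rnd n ?as ^^ t) start"
  note rd = r[unfolded ready_def, simplified]
  have Z0: "0 < Z" using M by (simp add: Z_def)
  show ?thesis
    unfolding main_code_def
    apply (simp add: rd)
    apply (rule wp_loop[where n = n and I = "\<lambda>t s. stores s (?t t)"])
    subgoal using rd by simp
    subgoal using N by simp
    subgoal using a Z0 by (auto simp: stores_def start_def)
    subgoal premises p for j v' a'
    proof -
      have r': "ready n l fs gs (v', a')"
        by (rule ready_frame[OF _ p(3)])
          (use rd in \<open>auto simp: ready_def codes_axioms tok_code_def shift_code_def relax_all_code_def relax_code_def\<close>)
      note rd' = r'[unfolded ready_def, simplified]
      have v21: "v' 21 = Z - 1"
        using p(3) rd by (simp add: frame_def tok_code_def shift_code_def relax_all_code_def relax_code_def)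
      let ?J = "\<lambda>i s. stores s (fold (tok n) (take i ?as) (?t j)) \<and> fst s 22 = 2 + i \<and> fst s 23 = 2 + n + i"
      show ?thesis
        apply (simp add: rd' v21)
        apply (rule wp_loop[where n = n and I = ?J])
        subgoal using rd' by simp
        subgoal using N by simp
        subgoal using p(2) rd' by (auto simp: stores_def)
        subgoal premises q for i v'' a''
        proof -
          have r'': "ready n l fs gs (v'', a'')"
            by (rule ready_frame[OF _ q(3)])
              (use rd' in \<open>auto simp: ready_def codes_axioms tok_code_def shift_code_def\<close>)
          have "(fs ! i, gs ! i) \<in> set (zip fs gs)" using q(1) fs by (auto simp: set_zip)
          then have pi: "(fs ! i, gs ! i) \<in> arcs" using fs(3) by blast
          have t: "take (Suc i) ?as = take i ?as @ [idx (fs ! i, gs ! i)]"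
            using q(1) fs by (simp add: take_Suc_conv_app_nth)
          show ?thesis
            apply (rule wp_mono)
             apply (rule wp_tok[OF r'' _ _ _ q(1) pi N(1-3), where t = "fold (tok n) (take i ?as) (?t j)"])
            using q(2) by (simp_all add: t)
        qed
        subgoal premises q for v'' a''
        proof -
          have r'': "ready n l fs gs (v'', a'')"
            by (rule ready_frame[OF _ q(2)])
              (use rd' in \<open>auto simp: ready_def codes_axioms tok_code_def shift_code_def\<close>)
          have v21': "v'' 21 = Z - 1"
            using q(2) v21 by (simp add: frame_def tok_code_def shift_code_def)
          have st: "stores (v'', a'') (fold (tok n) ?as (?t j))" using q(1) fs by simp
          have z: "\<forall>y\<ge>Z. a'' 6 y = 0" using st by (simp add: stores_def)
          show ?thesis
            apply (rule wp_mono)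
             apply (rule wp_relax_all[OF r'' v21' z N(1,2)])
            subgoal for v3 a3
              using st by (simp add: stores_def frame_def relax_all_code_def relax_code_def rnd_def Let_def
                  relax_all_def fold_relax_beyond)
            done
        qed
        done
    qed
    subgoal by (simp add: stores_def dp_def)
    done
qed

lemma wp_out:
  assumes "v 3 = 1" "v 6 = n" "v 5 = l" "a 6 0 = r"
  shows "wp N out_code (\<lambda>s. fst s 0 = (if r \<noteq> 0 \<and> n + 1 \<le> l + r then 1 else 0)) (v, a)"
  using assms by (simp add: out_code_def) linarith

section \<open>Precomputed sizes and balance tests\<close>

definition "weight f g = (\<Sum>p\<in>#g. Z ^ (f p - 1))" for f :: "nat \<times> nat \<Rightarrow> nat"
definition "tab b s \<longleftrightarrow> (\<forall>x<b. snd s 7 x = size (dec x) \<and> snd s 2 x = weight fst (dec x)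
  \<and> snd s 3 x = weight snd (dec x))" for b :: nat and s :: store

text \<open>The weight is the multiset of first or second colours written in base \<open>Z\<close>,
  one digit per colour, so that balance becomes a single comparison of numbers.\<close>

lemma weight_counts:
  assumes "\<forall>p\<in>#g. f p \<in> {1..c}"
  shows "weight f g = (\<Sum>i<c. count (image_mset f g) (Suc i) * Z ^ i)"
  using assms
proof (induction g)
  case (add p g)
  then have fp: "f p - 1 < c" "Suc (f p - 1) = f p" by auto
  have "(\<Sum>i<c. count (image_mset f (add_mset p g)) (Suc i) * Z ^ i)
      = (\<Sum>i<c. count (image_mset f g) (Suc i) * Z ^ i + (if i = f p - 1 then Z ^ i else 0))"
    using fp(2) by (intro sum.cong) auto
  also have "\<dots> = weight f g + Z ^ (f p - 1)" using add fp(1) by (simp add: sum.distrib)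
  finally show ?case by (simp add: weight_def)
qed (simp add: weight_def)

lemma balanced_iff_weight: "x < Z \<Longrightarrow> balanced (dec x) \<longleftrightarrow> weight fst (dec x) = weight snd (dec x)"
proof -
  assume x: "x < Z"
  \<comment> \<open>Every arc adds at least 1 to the code, so all colour counts stay below
    \<open>Z\<close> and the base-\<open>Z\<close> digits are faithful.\<close>
  have "size (dec x) \<le> (\<Sum>a<m. (x div M ^ a mod M) * M ^ a)"
    unfolding size_dec digit_sum_def using M by (intro sum_mono) simp
  also have "\<dots> \<le> x" by (simp add: sum_digits)
  finally have sz: "size (dec x) < Z" using x by simp
  have in1: "\<forall>p\<in>#dec x. fst p \<in> {1..c}" and in2: "\<forall>p\<in>#dec x. snd p \<in> {1..c}"
    using set_dec[of x] by (auto simp: arcs_def)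
  have d: "count (image_mset f (dec x)) (Suc i)
      = (\<Sum>i<c. count (image_mset f (dec x)) (Suc i) * Z ^ i) div Z ^ i mod Z" if "i < c" for f i
  proof -
    have "count (image_mset f (dec x)) (Suc i) < Z" for i
      using count_le_size[of "image_mset f (dec x)" "Suc i"] sz by simp
    then show ?thesis using digits_sum[of "\<lambda>i. count (image_mset f (dec x)) (Suc i)" Z c] that by simp
  qed
  show ?thesis
  proof
    assume w: "weight fst (dec x) = weight snd (dec x)"
    show "balanced (dec x)"
      unfolding balanced_def
    proof (rule multiset_eqI)
      fix i
      show "count (image_mset fst (dec x)) i = count (image_mset snd (dec x)) i"
      proof (cases "i \<in> {1..c}")
        case True
        then have "i - 1 < c" "Suc (i - 1) = i" by auto
        then show ?thesis
          using d[of "i - 1" fst] d[of "i - 1" snd] w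
          unfolding weight_counts[OF in1] weight_counts[OF in2] by metis
      next
        case False
        then have "i \<notin># image_mset fst (dec x)" "i \<notin># image_mset snd (dec x)" using in1 in2 by auto
        then show ?thesis by (metis not_in_iff)
      qed
    qed
  next
    assume "balanced (dec x)"
    then show "weight fst (dec x) = weight snd (dec x)"
      unfolding weight_counts[OF in1] weight_counts[OF in2] balanced_def by simp
  qed
qed

text \<open>Each new code is \<open>j + M ^ k\<close> with \<open>j\<close> already tabulated, and
  stands for one more arc \<open>k\<close>. Sizes and weights thus arise by additions, without
  decoding a number.\<close>

lemma wp_fill:
  assumes v: "v 3 = 1" "v 11 = M ^ k" "v 12 = Z ^ (fst (arc k) - 1)" "v 14 = Z ^ (snd (arc k) - 1)"
      "v 16 = M ^ Suc k - M ^ k"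
    and k: "k < m" and a: "tab (M ^ k) (v, a)" and N: "Z \<le> N"
  shows "wp N fill_code (\<lambda>s. tab (M ^ Suc k) s) (v, a)"
proof -
  have MZ: "M ^ Suc k \<le> Z" unfolding Z_def using k M by (intro power_increasing) auto
  have le: "M ^ k \<le> M ^ Suc k" using M by (intro power_increasing) auto
  show ?thesis
    unfolding fill_code_def
    apply simp
    apply (rule wp_loop[where n = "M ^ Suc k - M ^ k" and I = "\<lambda>j s. fst s 17 = j \<and> tab (M ^ k + j) s"])
    subgoal using v by simp
    subgoal using N MZ by simp
    subgoal using a by (simp add: tab_def)
    subgoal premises p for j v' a'
    proof -
      have fr: "v' 3 = 1" "v' 11 = M ^ k" "v' 12 = Z ^ (fst (arc k) - 1)" "v' 14 = Z ^ (snd (arc k) - 1)"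
        using p(3) v by (simp_all add: frame_def)
      have j: "v' 17 = j" "j < M ^ k + j" using p(2) M by simp_all
      have d: "dec (j + M ^ k) = add_mset (arc k) (dec j)"
        using p(1) by (intro dec_add_power[OF k]) simp
      show ?thesis
        using p(2) j fr d by (auto simp: tab_def weight_def less_Suc_eq add.commute)
    qed
    subgoal using le by simp
    done
qed

text \<open>As \<open>M = 2 ^ e\<close>, multiplication by \<open>M\<close> is \<open>e\<close>
  doublings and multiplication by \<open>Z\<close> is \<open>e * m\<close> doublings.\<close>

lemma wp_arc:
  assumes v: "v 3 = 1" "v 7 = m" "v 8 = e" "v 11 = M ^ k" "v 12 = Z ^ (fst (arc k) - 1)"
      "v 13 = k + c + 1" "v 14 = Z ^ (snd (arc k) - 1)" and M2: "M = 2 ^ e"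
    and k: "k < m" and a: "tab (M ^ k) (v, a)" "\<forall>i<k. a 4 (i + c + 1) = M ^ i"
    and N: "Z \<le> N" "m \<le> N" "e \<le> N"
  shows "wp N arc_code (\<lambda>s. tab (M ^ Suc k) s \<and> (\<forall>i<Suc k. snd s 4 (i + c + 1) = M ^ i)
      \<and> fst s 11 = M ^ Suc k \<and> fst s 13 = Suc k + c + 1 \<and> fst s 14 = Z ^ (snd (arc k) - 1) * Z) (v, a)"
proof -
  have Z2: "2 ^ (e * m) = Z" by (simp only: Z_def power_mult M2[symmetric])
  show ?thesis
    unfolding arc_code_def
    apply (simp add: v N)
    apply (rule wp_mono)
     apply (rule wp_fill[where k = k])
    using v a(1) k N
           apply (simp_all add: tab_def mult.commute flip: M2)
    subgoal premises p for v' a'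
    proof -
      have fr: "v' 7 = m" "v' 8 = e" "v' 13 = Suc (Suc (k + c))" "v' 14 = Z ^ (snd (arc k) - 1)"
        "v' 15 = M * M ^ k" "a' 4 = (a 4)(Suc (k + c) := M ^ k)"
        using p(2) v by (simp_all add: frame_def fill_code_def mult.commute)
      show ?thesis
        using p(1) N a(2) by (auto simp: fr Z2 less_Suc_eq mult.commute)
    qed
    done
qed

lemma wp_table:
  assumes v: "v 3 = 1" "v 4 = c" "v 7 = m" "v 8 = e" and M2: "M = 2 ^ e"
    and a: "a 7 0 = 0" "a 2 0 = 0" "a 3 0 = 0" and N: "Z \<le> N" "m \<le> N" "e \<le> N" "c \<le> N"
  shows "wp N table_code (\<lambda>s. tab Z s \<and> (\<forall>i<m. snd s 4 (i + c + 1) = M ^ i)) (v, a)"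
proof -
  have Z2: "2 ^ (e * m) = Z" by (simp only: Z_def power_mult M2[symmetric])
  let ?T = "\<lambda>k s. tab (M ^ k) s \<and> (\<forall>i<k. snd s 4 (i + c + 1) = M ^ i)
      \<and> fst s 11 = M ^ k \<and> fst s 13 = k + c + 1"
  let ?I = "\<lambda>i s. ?T (i * c) s \<and> fst s 12 = Z ^ i"
  show ?thesis
    unfolding table_code_def
    apply (simp add: v)
    apply (rule wp_loop[where n = c and I = ?I])
    subgoal using v by simp
    subgoal using N by simp
    subgoal using a v by (simp add: tab_def dec_0 weight_def)
    subgoal premises p for i v' a'
    proof -
      have fr: "v' 3 = 1" "v' 4 = c" "v' 7 = m" "v' 8 = e"
        using p(3) v by (simp_all add: frame_def arc_code_def fill_code_def)
      show ?thesis
        apply simp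
        apply (rule wp_loop[where n = c and I = "\<lambda>j s. ?T (i * c + j) s \<and> fst s 14 = Z ^ j"])
        subgoal using fr by simp
        subgoal using N by simp
        subgoal using p(2) by (simp add: tab_def)
        subgoal premises q for j v'' a''
        proof -
          have fr': "v'' 3 = 1" "v'' 7 = m" "v'' 8 = e" "v'' 12 = Z ^ i"
            using q(3) fr p(2) by (simp_all add: frame_def arc_code_def fill_code_def)
          have ar: "fst (arc (i * c + j)) - 1 = i" "snd (arc (i * c + j)) - 1 = j"
            using q(1) by (simp_all add: arc_def)
          have "i * c + j < (i + 1) * c" using q(1) by simp
          also have "\<dots> \<le> m" unfolding m_def using p(1) by (intro mult_right_mono) auto
          finally have k: "i * c + j < m" .
          show ?thesis
            apply (rule wp_mono)
             apply (rule wp_arc[where k = "i * c + j" and e = e])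
            using q(2) fr' ar k M2 N by (simp_all add: mult.commute)
        qed
        subgoal premises q for v'' a''
        proof -
          have fr': "v'' 7 = m" "v'' 8 = e" "v'' 12 = Z ^ i"
            using q(2) fr p(2) by (simp_all add: frame_def arc_code_def fill_code_def)
          then show ?thesis using q(1) N by (simp add: Z2 tab_def add.commute mult.commute)
        qed
        done
    qed
    subgoal by (simp add: Z_def m_def)
    done
qed

text \<open>Relocation delivers \<open>2 * n\<close>. It is halved by a variable alternating between
  0 and 1, so that only every second iteration counts.\<close>

lemma wp_init:
  assumes v: "v 2 = 2 * n" and a: "a 0 0 = c" "a 0 (Suc 0) = l"
    and N: "2 * n \<le> N" "c \<le> N" "m \<le> N" "m + 2 \<le> N"
  shows "wp N init_code (\<lambda>s. fst s 3 = 1 \<and> fst s 4 = c \<and> fst s 5 = l \<and> fst s 6 = n \<and> fst s 7 = m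
      \<and> fst s 8 = m + 2 \<and> fst s 9 = 2 ^ ((m + 2) * m) \<and> snd s = a) (v, a)"
  unfolding init_code_def
  apply (simp add: v a)
  apply (rule wp_loop[where n = "2 * n" and I = "\<lambda>j s. fst s 6 = j div 2 \<and> fst s 10 = j mod 2 \<and> snd s = a"])
  subgoal using v by simp
  subgoal using N by simp
  subgoal by simp
  subgoal for j v' a'
    by (simp add: frame_def) presburger
  subgoal for v' a'
    using N v by (simp add: frame_def m_def)
  done

theorem wp_swap_code:
  assumes M2: "M = 2 ^ (m + 2)" and v: "v 2 = 2 * n"
    and a: "a 0 0 = c" "a 0 (Suc 0) = l" "\<And>i. i < n \<Longrightarrow> a 0 (2 + i) = fs ! i"
      "\<And>i. i < n \<Longrightarrow> a 0 (2 + n + i) = gs ! i"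
      "\<And>k i. 1 \<le> k \<Longrightarrow> k < 8 \<Longrightarrow> a k i = 0"
    and fs: "length fs = n" "length gs = n" "set (zip fs gs) \<subseteq> arcs"
    and N: "2 * n \<le> N" "c \<le> N" "m + 2 \<le> N" "Z \<le> N"
  shows "wp N swap_code (\<lambda>s. fst s 0 = (let r = dp n (map idx (zip fs gs))
      in if r \<noteq> 0 \<and> n + 1 \<le> l + r then 1 else 0)) (v, a)"
proof -
  have Z2: "2 ^ ((m + 2) * m) = Z" by (simp only: Z_def power_mult M2[symmetric])
  show ?thesis
    unfolding swap_code_def
    apply simp
    apply (rule wp_mono, rule wp_init[where v = v and a = a and n = n and l = l, OF v a(1,2)])
    using N apply simp_all[4]
    subgoal premises p for v1 a1
      apply (simp only: wp_simps)
      apply (rule wp_mono, rule wp_table[where e = "m + 2"])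
      using p N M2 a(5) apply simp_all[12]
      subgoal premises q for v2 a2
      proof -
        have fr: "v2 3 = 1" "v2 4 = c" "v2 5 = l" "v2 6 = n" "v2 9 = Z" "a2 0 = a 0" "a2 5 = a 5" "a2 6 = a 6"
          using p(1) q(2) Z2 by (simp_all add: frame_def table_code_def arc_code_def fill_code_def)
        have r: "ready n l fs gs (v2, a2)"
          using q(1) fr a by (simp add: ready_def tab_def balanced_iff_weight)
        have z: "a2 5 = (\<lambda>_. 0)" "a2 6 = (\<lambda>_. 0)" using fr a(5) by auto
        show ?thesis
          apply (simp only: wp_simps)
          apply (rule wp_mono, rule wp_main[OF r z fs])
          using N apply simp_all[4]
          subgoal premises t for v3 a3
          proof -
            have fr': "v3 3 = 1" "v3 5 = l" "v3 6 = n"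
              using fr t(2) by (simp_all add: frame_def main_code_def tok_code_def shift_code_def
                  relax_all_code_def relax_code_def)
            show ?thesis
              apply (rule wp_mono, rule wp_out[OF fr'(1,3,2)])
              using t(1) by (simp_all add: Let_def)
          qed
          done
      qed
      done
    done
qed

end

section \<open>Input relocation and the theorem\<close>

text \<open>The input occupies the registers of the variables and leaves no free one, so it is moved first:
  128 * n exceeds all input addresses (unless n = 0, which is sent to tgt) and is computed in place;
  entry i of c # l # f0 @ ft goes to 128 * n + 8 * i. Colours are positive, so a zero ends the input.
  The end pointers then give back n and the array base.\<close>

definition "boot tgt = (Jz 0 tgt # replicate 7 (Add 0 0 0)
    @ [StoreI 0 1, LoadC 1 8, Add 0 0 1, StoreI 0 2, Add 0 0 1, StoreI 0 3, LoadC 2 4])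
  @ [LoadI 3 2, Jz 3 23, Add 0 0 1, StoreI 0 3, LoadC 3 1, Add 2 2 3, LoadC 3 0, Jz 3 15]
  @ [LoadC 67 0, LoadC 68 1, LoadC 3 16, Add 66 0 3] @ replicate 8 (Sub 66 66 2)
  @ [LoadC 3 3, Sub 2 2 3]"

lemma length_boot [simp]: "length (boot tgt) = 37"
  by (simp add: boot_def)

lemma effect_doubling: "effect (replicate j (Add 0 0 0) @ is) R = effect is (R(0 := 2 ^ j * R 0))"
  by (induction j arbitrary: R) (simp_all add: distrib_left distrib_right mult_2)

lemma effect_sub: "r \<noteq> y \<Longrightarrow> effect (replicate j (Sub r r y) @ is) R = effect is (R(r := R r - j * R y))"
  by (induction j arbitrary: R) (auto simp: fun_eq_iff algebra_simps intro!: arg_cong[of _ _ "effect is"])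

lemma run_straight':
  assumes "list_all straight is" "length is = k" "length pre = p"
  shows "(step (pre @ is @ post) ^^ k) (p, R) = (p + k, effect is R)"
  using run_straight[OF assms(1)] assms(2,3) by blast

lemma boot_start:
  assumes "R 0 = n" "0 < n"
  shows "(step (boot tgt @ post) ^^ 15) (0, R) = (15, R(0 := 128 * n + 16, 1 := 8, 2 := 4,
     128 * n := R 1, 128 * n + 8 := R 2, 128 * n + 16 := R 3))"
proof -
  let ?A = "[StoreI 0 1, LoadC 1 8, Add 0 0 1, StoreI 0 2, Add 0 0 1, StoreI 0 3, LoadC 2 4]"
  let ?is = "replicate 7 (Add 0 0 0) @ ?A"
  let ?post = "[LoadI 3 2, Jz 3 23, Add 0 0 1, StoreI 0 3, LoadC 3 1, Add 2 2 3, LoadC 3 0, Jz 3 15]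
      @ [LoadC 67 0, LoadC 68 1, LoadC 3 16, Add 66 0 3] @ replicate 8 (Sub 66 66 2)
      @ [LoadC 3 3, Sub 2 2 3] @ post"
  have P: "boot tgt @ post = [Jz 0 tgt] @ ?is @ ?post" by (simp add: boot_def)
  have "(step ([Jz 0 tgt] @ ?is @ ?post) ^^ 14) (1, R) = (1 + 14, effect ?is R)"
    by (rule run_straight') (simp_all add: list_all_iff)
  then have 2: "(step (boot tgt @ post) ^^ 14) (1, R) = (15, effect ?is R)"
    unfolding P by (simp del: effect_simps funpow.simps)
  have e: "effect ?is R = R(0 := 128 * n + 16, 1 := 8, 2 := 4,
     128 * n := R 1, 128 * n + 8 := R 2, 128 * n + 16 := R 3)"
    unfolding effect_doubling using assms by (auto simp: fun_eq_iff)
  have "(step (boot tgt @ post) ^^ 1) (0, R) = (1, R)"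
    using assms by (simp add: step_def boot_def)
  from funpow_trans[OF this 2] show ?thesis unfolding e by simp
qed

lemma boot_loop:
  assumes "R (R 2) \<noteq> 0" "4 \<le> R 2" "4 \<le> R 0 + R 1"
  shows "(step (boot tgt @ post) ^^ 8) (15, R) = (15, R(0 := R 0 + R 1, 2 := R 2 + 1, 3 := 0,
      R 0 + R 1 := R (R 2)))"
proof -
  define pre where "pre = Jz 0 tgt # replicate 7 (Add 0 0 0)
    @ [StoreI 0 1, LoadC 1 8, Add 0 0 1, StoreI 0 2, Add 0 0 1, StoreI 0 3, LoadC 2 4]"
  let ?is = "[Add 0 0 1, StoreI 0 3, LoadC 3 1, Add 2 2 3, LoadC 3 0]"
  define rest where "rest = [LoadC 67 0, LoadC 68 1, LoadC 3 16, Add 66 0 3] @ replicate 8 (Sub 66 66 2)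
      @ [LoadC 3 3, Sub 2 2 3] @ post"
  have P: "boot tgt @ post = pre @ [LoadI 3 2, Jz 3 23] @ ?is @ Jz 3 15 # rest"
    by (simp add: boot_def pre_def rest_def)
  have l: "length pre = 15" by (simp add: pre_def)
  let ?R1 = "R(3 := R (R 2))"
  have 1: "(step (boot tgt @ post) ^^ 2) (15, R) = (17, ?R1)"
    unfolding P using assms l by (simp add: step_def eval_nat_numeral nth_append)
  have 2: "(step (boot tgt @ post) ^^ 5) (17, ?R1) = (22, effect ?is ?R1)"
  proof -
    have "(step ((pre @ [LoadI 3 2, Jz 3 23]) @ ?is @ Jz 3 15 # rest) ^^ 5) (17, ?R1) = (17 + 5, effect ?is ?R1)"
      by (rule run_straight') (simp_all add: l)
    then show ?thesis unfolding P by (simp del: effect_simps funpow.simps)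
  qed
  have e: "effect ?is ?R1 = R(0 := R 0 + R 1, 2 := R 2 + 1, 3 := 0, R 0 + R 1 := R (R 2))"
    using assms by (auto simp: fun_eq_iff)
  have 3: "(step (boot tgt @ post) ^^ 1) (22, R') = (15, R')" if "R' 3 = 0" for R'
    unfolding P using that l step_at[of "pre @ [LoadI 3 2, Jz 3 23] @ ?is" "Jz 3 15" rest R'] by simp
  have "(effect ?is ?R1) 3 = 0" unfolding e using assms by auto
  from funpow_trans[OF 1 funpow_trans[OF 2 3[where R' = "effect ?is ?R1", OF this]]] show ?thesis unfolding e by simp
qed

text \<open>For \<open>R 0 = 128 * n + 16 + 8 * j\<close> and \<open>R 2 = 4 + j\<close>, the new
  value of register 66 is free of \<open>j\<close> and equals the base
  \<open>128 * n\<close>.\<close>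

lemma boot_exit:
  assumes "R (R 2) = 0"
  shows "(step (boot tgt @ post) ^^ 16) (15, R)
     = (37, R(67 := 0, 68 := 1, 66 := R 0 + 16 - 8 * R 2, 3 := 3, 2 := R 2 - 3))"
proof -
  define pre where "pre = (Jz 0 tgt # replicate 7 (Add 0 0 0)
    @ [StoreI 0 1, LoadC 1 8, Add 0 0 1, StoreI 0 2, Add 0 0 1, StoreI 0 3, LoadC 2 4])"
  define mid where "mid = [Add 0 0 1, StoreI 0 3, LoadC 3 1, Add 2 2 3, LoadC 3 0, Jz 3 15]"
  let ?B = "[LoadC 67 0, LoadC 68 1, LoadC 3 16, Add 66 0 3]"
  let ?is = "?B @ replicate 8 (Sub 66 66 2) @ [LoadC 3 3, Sub 2 2 3]"
  have P: "boot tgt @ post = pre @ [LoadI 3 2, Jz 3 23] @ mid @ ?is @ post"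
    by (simp add: boot_def pre_def mid_def)
  have l: "length pre = 15" "length mid = 6" by (simp_all add: pre_def mid_def)
  let ?R1 = "R(3 := R (R 2))"
  have 1: "(step (boot tgt @ post) ^^ 2) (15, R) = (23, ?R1)"
    unfolding P using assms l by (simp add: step_def eval_nat_numeral nth_append)
  have "(step ((pre @ [LoadI 3 2, Jz 3 23] @ mid) @ ?is @ post) ^^ 14) (23, ?R1) = (23 + 14, effect ?is ?R1)"
    by (rule run_straight') (simp_all add: l list_all_iff)
  then have 2: "(step (boot tgt @ post) ^^ 14) (23, ?R1) = (37, effect ?is ?R1)"
    unfolding P by (simp del: effect_simps funpow.simps)
  have e: "effect ?is ?R1 = R(67 := 0, 68 := 1, 66 := R 0 + 16 - 8 * R 2, 3 := 3, 2 := R 2 - 3)"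
    by (simp add: effect_sub)
  from funpow_trans[OF 1 2] show ?thesis unfolding e by simp
qed

lemma boot_correct:
  fixes n c l :: nat and ts :: "nat list"
  assumes len: "length ts = 2 * n" and pos: "0 < n" "0 \<notin> set ts"
  shows "\<exists>R v a. (step (boot tgt @ post) ^^ (15 + 8 * (2 * n - 1) + 16)) (init_config ([n, c, l] @ ts)) = (37, R)
    \<and> sim (128 * n) (v, a) R \<and> v 2 = 2 * n \<and> a 0 0 = c \<and> a 0 (Suc 0) = l
    \<and> (\<forall>i < 2 * n. a 0 (2 + i) = ts ! i) \<and> (\<forall>k i. 1 \<le> k \<longrightarrow> k < 8 \<longrightarrow> a k i = 0)"
proof -
  let ?P = "boot tgt @ post"
  define I where "I = snd (init_config ([n, c, l] @ ts))"
  have ic: "init_config ([n, c, l] @ ts) = (0, I)" by (simp add: I_def init_config_def)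
  have I012: "I 0 = n" "I 1 = c" "I 2 = l" by (simp_all add: I_def init_config_def)
  have I3: "I (3 + i) = (if i < 2 * n then ts ! i else 0)" for i
    by (simp add: I_def init_config_def len nth_append numeral_3_eq_3)
  have I0: "I x = 0" if "2 * n + 3 \<le> x" for x
  proof -
    have "3 + (x - 3) = x" "\<not> x - 3 < 2 * n" using that by auto
    then show ?thesis using I3[of "x - 3"] by simp
  qed
  \<comment> \<open>\<open>boot_start\<close> has already moved \<open>ts ! 0\<close>, since
    register 3 serves as scratch in the loop; \<open>j\<close> counts the further entries. The last
    clause leaves arrays 1 to 7 empty, as the program expects.\<close>
  define J where "J j R \<longleftrightarrow> R 0 = 128 * n + 16 + 8 * j \<and> R 1 = 8 \<and> R 2 = 4 + j
     \<and> R (128 * n) = c \<and> R (128 * n + 8) = l \<and> (\<forall>i\<le>j. R (128 * n + 16 + 8 * i) = ts ! i)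
     \<and> (\<forall>x. 4 \<le> x \<longrightarrow> x < 128 * n \<longrightarrow> R x = I x) \<and> (\<forall>x\<ge>128 * n. x mod 8 \<noteq> 0 \<longrightarrow> R x = 0)"
    for j :: nat and R :: "nat \<Rightarrow> nat"
  have "\<exists>R. (step ?P ^^ (15 + 8 * j)) (0, I) = (15, R) \<and> J j R" if "j \<le> 2 * n - 1" for j
    using that
  proof (induction j)
    case 0
    let ?R = "I(0 := 128 * n + 16, 1 := 8, 2 := 4,
       128 * n := I 1, 128 * n + 8 := I 2, 128 * n + 16 := I 3)"
    have "I 3 = ts ! 0" using I3[of 0] pos by simp
    then have "J 0 ?R" using I012 I0 pos by (auto simp: J_def)
    then show ?case using boot_start[where R = I, OF I012(1) pos(1), of tgt post] by auto
  next
    case (Suc j)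
    then obtain R where R: "(step ?P ^^ (15 + 8 * j)) (0, I) = (15, R)" "J j R" by auto
    have "R (4 + j) = I (4 + j)" using R(2) Suc.prems by (simp add: J_def)
    also have "\<dots> = ts ! Suc j" using I3[of "Suc j"] Suc.prems pos by (simp, linarith)
    finally have r: "R (R 2) = ts ! Suc j" using R(2) by (simp add: J_def)
    moreover have "ts ! Suc j \<noteq> 0"
    proof -
      have "Suc j < length ts" using Suc.prems pos len by simp
      then show ?thesis using pos(2) nth_mem by metis
    qed
    ultimately have s: "(step ?P ^^ 8) (15, R) = (15, R(0 := R 0 + R 1, 2 := R 2 + 1, 3 := 0,
        R 0 + R 1 := R (R 2)))"
      using R(2) by (intro boot_loop[where R = R]) (auto simp: J_def)
    have "J (Suc j) (R(0 := R 0 + R 1, 2 := R 2 + 1, 3 := 0, R 0 + R 1 := R (R 2)))"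
    proof -
      have a: "R 0 + R 1 = 128 * n + 16 + 8 * Suc j" using R(2) by (simp add: J_def)
      have m: "(128 * n + 16 + 8 * Suc j) mod 8 = 0" by presburger
      show ?thesis
        unfolding r a using R(2) pos m by (auto simp: J_def le_Suc_eq)
    qed
    then show ?case using funpow_trans[OF R(1) s] by (auto simp: add_ac)
  qed
  then obtain R where R: "(step ?P ^^ (15 + 8 * (2 * n - 1))) (0, I) = (15, R)" "J (2 * n - 1) R"
    by blast
  have "R (4 + (2 * n - 1)) = I (4 + (2 * n - 1))" using R(2) pos by (simp add: J_def)
  \<comment> \<open>The read pointer stands at \<open>2 * n + 3\<close>, the first register behind
    the input, which is still zero because the copies start at \<open>128 * n\<close>.\<close>
  then have "R (R 2) = 0" using R(2) I0 pos by (simp add: J_def)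
  note ex = boot_exit[where R = R, OF this, of tgt post]
  define R' where "R' = R(67 := 0, 68 := 1, 66 := R 0 + 16 - 8 * R 2, 3 := 3, 2 := R 2 - 3)"
  have base: "R 0 + 16 - 8 * R 2 = 128 * n" "R 2 - 3 = 2 * n"
    using R(2) pos by (auto simp: J_def)
  define a where "a = (\<lambda>k i. R' (128 * n + 8 * i + k))"
  have "sim (128 * n) (R', a) R'"
    using base pos by (auto simp: sim_def R'_def a_def)
  moreover have "R' 2 = 2 * n" using base by (simp add: R'_def)
  moreover have "a 0 0 = c" "a 0 (Suc 0) = l"
    using R(2) pos by (auto simp: a_def R'_def J_def)
  moreover have "a 0 (2 + i) = ts ! i" if "i < 2 * n" for i
  proof -
    have "R (128 * n + 16 + 8 * i) = ts ! i" using R(2) that by (simp add: J_def)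
    then show ?thesis using pos by (simp add: a_def R'_def add.assoc)
  qed
  moreover have "a k i = 0" if "1 \<le> k" "k < 8" for k i
  proof -
    have "(128 * n + 8 * i + k) mod 8 \<noteq> 0" using that by presburger
    then show ?thesis using R(2) pos by (auto simp: a_def R'_def J_def)
  qed
  moreover have "(step ?P ^^ (15 + 8 * (2 * n - 1) + 16)) (init_config ([n, c, l] @ ts)) = (37, R')"
    unfolding ic R'_def by (rule funpow_trans[OF R(1) ex])
  ultimately show ?thesis by blast
qed

text \<open>The empty instance, for which relocation has no room, is always accepted: it goes
  straight to the final \<open>LoadC 0 1\<close>, which all other runs jump over.\<close>

definition "swap_prog = (let L = 37 + length (compile 0 37 swap_code)
  in boot (Suc L) @ compile 0 37 swap_code @ [Jz 67 (L + 2), LoadC 0 1])"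

lemma well_formed_swap_code: "well_formed 0 swap_code"
  by (simp add: swap_code_def init_code_def table_code_def arc_code_def fill_code_def main_code_def
      tok_code_def shift_code_def relax_all_code_def relax_code_def out_code_def)

lemma halts_empty: "halts_within swap_prog [0, c, l] 2 1"
proof -
  let ?L = "37 + length (compile 0 37 swap_code)"
  let ?I = "snd (init_config [0, c, l])"
  have P: "swap_prog = Jz 0 (Suc ?L) # tl swap_prog"
    by (simp add: swap_prog_def Let_def boot_def)
  have 1: "step swap_prog (0, ?I) = (Suc ?L, ?I)"
    using step_at[of "[]" "Jz 0 (Suc ?L)" "tl swap_prog" ?I] P by (simp add: init_config_def)
  have Q: "swap_prog = (boot (Suc ?L) @ compile 0 37 swap_code @ [Jz 67 (?L + 2)]) @ LoadC 0 1 # []"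
    by (simp add: swap_prog_def Let_def)
  have 2: "step swap_prog (Suc ?L, ?I) = (Suc (Suc ?L), ?I(0 := 1))"
    using step_at[of "boot (Suc ?L) @ compile 0 37 swap_code @ [Jz 67 (?L + 2)]" "LoadC 0 1" "[]" ?I]
    by (simp add: Q del: One_nat_def)
  have "(step swap_prog ^^ 2) (init_config [0, c, l]) = (Suc (Suc ?L), ?I(0 := 1))"
    using 1 2 by (simp add: eval_nat_numeral init_config_def)
  moreover have "length swap_prog = Suc (Suc ?L)" by (simp add: Q)
  ultimately show ?thesis unfolding halts_within_def by (intro exI[of _ 2]) simp
qed

lemma halts_nonempty:
  assumes tp: "token_placement n c f" "token_placement n c ft" and n: "0 < n"
    and N: "2 * n \<le> N" "c \<le> N" "c * c + 2 \<le> N" "2 ^ ((c * c + 2) * (c * c)) \<le> N"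
    and T: "\<And>s. safe N swap_code s \<Longrightarrow> cost swap_code s \<le> T"
  shows "halts_within swap_prog ([n, c, l] @ f @ ft) (32 + 16 * n + T)
     (if OPT n c complete_graph f ft \<le> enat l then 1 else 0)"
proof -
  have c: "1 \<le> c"
  proof (rule ccontr)
    assume "\<not> 1 \<le> c"
    then have "set f = {}" using tp by (auto simp: token_placement_def)
    then show False using tp n by (auto simp: token_placement_def)
  qed
  interpret codes c "2 ^ (c * c + 2)" using c by unfold_locales auto
  have m: "m = c * c" by (simp add: m_def)
  have Z: "Z = 2 ^ ((c * c + 2) * (c * c))" by (simp only: Z_def m power_mult)
  have len: "length f = n" "length ft = n" using tp by (auto simp: token_placement_def)
  have sets: "set f = {1..c}" "set ft = {1..c}" using tp by (auto simp: token_placement_def)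
  let ?ps = "zip f ft"
  have arcs: "set ?ps \<subseteq> arcs" using sets by (auto simp: arcs_def dest: set_zip_leftD set_zip_rightD)
  let ?L = "37 + length (compile 0 37 swap_code)"
  have P: "swap_prog = boot (Suc ?L) @ compile 0 37 swap_code @ [Jz 67 (?L + 2), LoadC 0 1]"
    by (simp add: swap_prog_def Let_def)
  have "length (f @ ft) = 2 * n" "0 \<notin> set (f @ ft)" using len sets by auto
  from boot_correct[OF this(1) n this(2), of "Suc ?L" "compile 0 37 swap_code @ [Jz 67 (?L + 2), LoadC 0 1]" c l]
  obtain R v a where B: "(step swap_prog ^^ (15 + 8 * (2 * n - 1) + 16)) (init_config ([n, c, l] @ f @ ft)) = (37, R)"
    "sim (128 * n) (v, a) R" "v 2 = 2 * n" "a 0 0 = c" "a 0 (Suc 0) = l"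
    "\<And>i. i < 2 * n \<Longrightarrow> a 0 (2 + i) = (f @ ft) ! i" "\<And>k i. 1 \<le> k \<Longrightarrow> k < 8 \<Longrightarrow> a k i = 0"
    unfolding P by blast
  have a1: "a 0 (2 + i) = f ! i" if "i < n" for i
    using B(6)[of i] that len by (simp add: nth_append)
  have a2: "a 0 (2 + n + i) = ft ! i" if "i < n" for i
    using B(6)[of "n + i"] that len by (simp add: nth_append add.assoc)
  let ?r = "dp n (map idx ?ps)"
  let ?y = "if OPT n c complete_graph f ft \<le> enat l then 1 else 0 :: nat"
  have "(\<exists>k. n \<le> l + k \<and> splits (mset ?ps) k) \<longleftrightarrow> ?r \<noteq> 0 \<and> n + 1 \<le> l + ?r"
  proof (rule dp_correct[OF _ arcs _ n])
    have "x + 2 \<le> x * 4" if "1 \<le> x" for x :: nat using that by linarith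
    from this[of "2 ^ m"] show "2 ^ m + 2 \<le> (2 :: nat) ^ (c * c + 2)" by (simp add: m power_add)
  qed (use len in simp)
  then have y: "?y = (let r = ?r in if r \<noteq> 0 \<and> n + 1 \<le> l + r then 1 else 0)"
    using OPT_le_iff_splits[OF tp, of l] by (simp add: pairs_def Let_def)
  have W: "wp N swap_code (\<lambda>s. fst s 0 = ?y) (v, a)"
    unfolding y
    by (rule wp_swap_code[where v = v and a = a and n = n and l = l and fs = f and gs = ft, OF _ B(3,4,5) a1 a2 B(7) len arcs])
      (use N in \<open>simp_all only: m Z\<close>)
  have cost: "cost swap_code (v, a) \<le> T" using W T by (simp add: wp_def)
  obtain R' where R': "(step swap_prog ^^ cost swap_code (v, a)) (37, R) = (?L, R')"
      "sim (128 * n) (sem swap_code (v, a)) R'"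
    using compile_correct[OF well_formed_swap_code B(2), of "boot (Suc ?L)" "[Jz 67 (?L + 2), LoadC 0 1]"]
    unfolding P by auto
  have out: "R' 0 = ?y" "R' 67 = 0" using R'(2) W by (auto simp: sim_def wp_def)
  have "swap_prog = (boot (Suc ?L) @ compile 0 37 swap_code) @ Jz 67 (?L + 2) # [LoadC 0 1]"
    by (simp add: P)
  then have J: "(step swap_prog ^^ 1) (?L, R') = (?L + 2, R')"
    using step_at[of "boot (Suc ?L) @ compile 0 37 swap_code" "Jz 67 (?L + 2)" "[LoadC 0 1]" R'] out by simp
  have "length swap_prog = ?L + 2" by (simp add: P)
  with funpow_trans[OF B(1) funpow_trans[OF R'(1) J]] out cost n show ?thesis
    unfolding halts_within_def
    by (intro exI[of _ "15 + 8 * (2 * n - 1) + 16 + (cost swap_code (v, a) + 1)"]) auto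
qed

section \<open>A computable time bound\<close>

definition "bound_code k =
  Const 4 0 ;; Plus 4 4 0 ;; Const 7 0 ;; Loop 4 (Plus 7 7 4) ;; Const 10 2 ;; Plus 8 7 10 ;;
  Const 20 k ;; Const 21 0 ;; Loop 7 (Plus 21 21 8) ;; Const 22 0 ;; Loop 20 (Plus 22 22 21) ;;
  Plus 22 22 20 ;; Const 0 1 ;; Loop 22 (Plus 0 0 0)"

lemma ram_computable_bound: "ram_computable (\<lambda>x. 2 ^ (k * ((x * x) * (x * x + 2)) + k))"
  unfolding ram_computable_def
proof (intro exI allI)
  fix x
  let ?pre = "[LoadC 67 0, LoadC 68 1, LoadC 66 128]"
  let ?C = "compile 0 3 (bound_code k)"
  let ?P = "?pre @ ?C"
  let ?I = "snd (init_config [x])"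
  define R where "R = ?I(67 := 0, 68 := 1, 66 := 128)"
  define a where "a = (\<lambda>k i. R (128 + 8 * i + k))"
  have 1: "(step ?P ^^ 3) (init_config [x]) = (3, R)"
  proof -
    have "(step ([] @ ?pre @ ?C) ^^ 3) (0, ?I) = (0 + 3, effect ?pre ?I)"
      by (rule run_straight') simp_all
    then show ?thesis by (simp add: R_def init_config_def del: funpow.simps)
  qed
  have s: "sim 128 (R, a) R" by (simp add: sim_def a_def R_def)
  have R0: "R 0 = x" by (simp add: R_def init_config_def)
  let ?N = "k * ((x * x) * (x * x + 2)) + k + x * x + x"
  have "wp ?N (bound_code k) (\<lambda>s. fst s 0 = 2 ^ (k * ((x * x) * (x * x + 2)) + k)) (R, a)"
    by (simp add: bound_code_def R0)
  then have r: "fst (sem (bound_code k) (R, a)) 0 = 2 ^ (k * ((x * x) * (x * x + 2)) + k)"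
    by (simp add: wp_def)
  have "well_formed 0 (bound_code k)" by (simp add: bound_code_def)
  from compile_correct[OF this s, of ?pre "[]"]
  obtain R' where R': "(step ?P ^^ cost (bound_code k) (R, a)) (3, R) = (3 + length ?C, R')"
      "sim 128 (sem (bound_code k) (R, a)) R'" by (auto simp: numeral_3_eq_3)
  have "R' 0 = 2 ^ (k * ((x * x) * (x * x + 2)) + k)" using R'(2) r by (simp add: sim_def)
  with funpow_trans[OF 1 R'(1)]
  show "halts_within ?P [x] (3 + cost (bound_code k) (R, a)) (2 ^ (k * ((x * x) * (x * x + 2)) + k))"
    unfolding halts_within_def by (intro exI[of _ "3 + cost (bound_code k) (R, a)"]) simp
qed

theorem mainTheorem16:
  shows "\<exists>(P :: instr list) (g :: nat \<Rightarrow> nat) (d :: nat).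
     ram_computable g \<and>
     (\<forall>n c l f0 ft.
        token_placement n c f0 \<and> token_placement n c ft \<longrightarrow>
        halts_within P ([n, c, l] @ f0 @ ft) (g c * (n + 1) ^ d)
          (if OPT n c complete_graph f0 ft \<le> enat l then 1 else 0))"
proof -
  obtain K d where Kd: "\<And>N s. safe N swap_code s \<Longrightarrow> cost swap_code s \<le> K * (N + 1) ^ d"
    using cost_poly[of swap_code] by blast
  \<comment> \<open>One constant for two purposes: \<open>z ^ d \<le> z ^ k\<close> and
    \<open>32 + K * 4 ^ d \<le> 2 ^ k\<close>.\<close>
  define k where "k = d + (32 + K * 4 ^ d)"
  define g where "g = (\<lambda>x :: nat. 2 ^ (k * ((x * x) * (x * x + 2)) + k) :: nat)"
  have "halts_within swap_prog ([n, c, l] @ f0 @ ft) (g c * (n + 1) ^ (d + 1))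
          (if OPT n c complete_graph f0 ft \<le> enat l then 1 else 0)"
    if tp: "token_placement n c f0" "token_placement n c ft" for n c l f0 ft
  proof (cases "n = 0")
    case True
    then have e: "f0 = []" "ft = []" using tp by (auto simp: token_placement_def)
    have "splits (pairs f0 ft) 0" by (simp add: e pairs_def splits_def)
    then have O: "OPT n c complete_graph f0 ft \<le> enat l"
      using OPT_le_iff_splits[OF tp, of l] True by auto
    \<comment> \<open>The empty instance takes two steps.\<close>
    have "2 ^ 1 \<le> g c" unfolding g_def k_def by (intro power_increasing) auto
    then show ?thesis
      using halts_empty[of c l] O True by (auto simp: e halts_within_def intro: le_trans)
  next
    case False
    have c: "1 \<le> c"
    proof (rule ccontr)
      assume "\<not> 1 \<le> c"
      then have "set f0 = {}" using tp by (auto simp: token_placement_def)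
      then show False using tp False by (auto simp: token_placement_def)
    qed
    define z :: nat where "z = 2 ^ ((c * c + 2) * (c * c))"
    \<comment> \<open>Loops run over codes, up to \<open>z\<close>, or over the input, up to
      \<open>2 * n\<close>. The product bounds both and separates into a factor in c and one in
      n.\<close>
    define N where "N = z * (2 * (n + 1))"
    have z: "1 \<le> z" "c * c + 2 \<le> z" "c \<le> z"
    proof -
      have "c * c + 2 \<le> (c * c + 2) * (c * c)" using c by (cases c) auto
      then have "c * c + 2 \<le> z"
        unfolding z_def by (meson le_trans less_imp_le less_exp)
      then show "c * c + 2 \<le> z" "1 \<le> z" "c \<le> z"
        using c by (auto intro: le_trans[OF le_square])
    qed
    have zN: "z \<le> N" "2 * n \<le> N"
      using z(1) mult_le_mono[of 1 z "2 * n" "2 * (n + 1)"] by (simp_all add: N_def)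
    have "N + 1 \<le> 4 * z * (n + 1)"
      using z(1) mult_mono[of 1 z 1 "n + 1"] by (simp add: N_def algebra_simps)
    then have "K * (N + 1) ^ d \<le> K * (4 * z * (n + 1)) ^ d"
      by (intro mult_left_mono power_mono) auto
    then have T: "cost swap_code s \<le> K * (4 * z * (n + 1)) ^ d" if "safe N swap_code s" for s
      using Kd[OF that] by linarith
    have b: "32 + 16 * n + K * (4 * z * (n + 1)) ^ d \<le> g c * (n + 1) ^ (d + 1)"
    proof -
      \<comment> \<open>Relocation is linear in n; the exponent \<open>d + 1\<close> absorbs it even
        for \<open>d = 0\<close>.\<close>
      have "32 + 16 * n \<le> 32 * (n + 1)" by simp
      also have "\<dots> \<le> 32 * (z ^ d * (n + 1) ^ (d + 1))"
      proof (rule mult_left_mono)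
        have "n + 1 \<le> (n + 1) ^ (d + 1)" by (rule self_le_power) auto
        with z(1) show "n + 1 \<le> z ^ d * (n + 1) ^ (d + 1)"
          using mult_le_mono[of 1 "z ^ d" "n + 1" "(n + 1) ^ (d + 1)"] by simp
      qed simp
      finally have 1: "32 + 16 * n \<le> 32 * (z ^ d * (n + 1) ^ (d + 1))" .
      have "(4 * z * (n + 1)) ^ d = 4 ^ d * (z ^ d * (n + 1) ^ d)"
        by (simp only: power_mult_distrib mult.assoc)
      also have "\<dots> \<le> 4 ^ d * (z ^ d * (n + 1) ^ (d + 1))"
        by (intro mult_left_mono power_increasing) auto
      finally have "K * (4 * z * (n + 1)) ^ d \<le> K * (4 ^ d * (z ^ d * (n + 1) ^ (d + 1)))"
        by (rule mult_left_mono) simp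
      with 1 have "32 + 16 * n + K * (4 * z * (n + 1)) ^ d
          \<le> (32 + K * 4 ^ d) * (z ^ d * (n + 1) ^ (d + 1))"
        by (simp add: algebra_simps)
      also have "\<dots> \<le> 2 ^ k * (z ^ k * (n + 1) ^ (d + 1))"
      proof (intro mult_mono)
        show "32 + K * 4 ^ d \<le> 2 ^ k"
        proof -
          have "32 + K * 4 ^ d \<le> k" by (simp add: k_def)
          then show ?thesis using less_exp[of k] by linarith
        qed
        show "z ^ d \<le> z ^ k" using z(1) by (intro power_increasing) (auto simp: k_def)
      qed auto
      also have "\<dots> = g c * (n + 1) ^ (d + 1)"
      proof -
        have "z ^ k = 2 ^ (k * ((c * c) * (c * c + 2)))"
          unfolding z_def by (simp only: power_mult[symmetric] mult_ac)
        then show ?thesis unfolding g_def power_add by (simp only: mult_ac)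
      qed
      finally show ?thesis .
    qed
    show ?thesis
      using halts_nonempty[OF tp _ zN(2) _ _ _ T, of l] False z zN b
      by (auto simp: halts_within_def z_def intro: le_trans)
  qed
  moreover have "ram_computable g" unfolding g_def by (rule ram_computable_bound)
  ultimately show ?thesis by blast
qed

end
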